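(* Let $1\le r\le\infty$ and let $(X,Y)$ be an $r$-separable pair of directed graphs. Then the commutative diagram of groupoids induced by inclusions $$\begin{array}{ccc} \Pi_1^{r}(X\cap Y)&\to&\Pi_1^{r}(X)\\ \downarrow&&\downarrow\\ \Pi_1^{r}(Y)&\to&\Pi_1^{r}(X\cup Y) \end{array}$$ is a pushout of groupoids.
   Context: A directed graph $X$ consists of a vertex set $V(X)$ and an edge set $E(X)\subset V(X)\times V(X)-\Delta$, where $\Delta$ is the diagonal. A map $f\colon X\to Y$ is a function $V(X)\to V(Y)$ such that for every $(x,y)\in E(X)$ either $(f(x),f(y))\in E(Y)$ or $f(x)=f(y)$; it is a homomorphism if always $(f(x),f(y))\in E(Y)$. Unions and intersections of directed graphs are taken on vertex sets and edge sets. For vertices $x,y$, $d(x,y)$ is the minimal length of a directed edge path from $x$ to $y$ ($\infty$ if none), and $L(x_0,\ldots,x_n)=\sum_{i=0}^{n-1}d(x_i,x_{i+1})$. For $1\le r<\infty$, $\mathrm{N}^r(X)$ is the simplicial set whose $n$-simplices are the tuples $(x_0,\ldots,x_n)\in V(X)^{n+1}$ with $L(x_0,\ldots,x_n)\le r$, with faces deleting and degeneracies repeating entries; $\mathrm{N}^\infty(X)$ is defined likewise with $L<\infty$. The $r$-fundamental groupoid $\Pi_1^r(X)$, $1\le r\le\infty$, is the edge-path groupoid of $\mathrm{N}^r(X)$: objects are the vertices of $X$, and it is generated by the $1$-simplices $(x,y)$ (as morphisms $x\to y$) subject to $(x,x)=1_x$ and, for each $2$-simplex $(x,y,z)$, that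 $(x,z)$ equals $(x,y)$ followed by $(y,z)$. It is functorial for maps. Paths: $\mathcal{I}_0$ consists of the one-vertex graph with vertex $0$; for $n\ge1$, $\mathcal{I}_n$ is the set of directed graphs with vertex set $\{0,\ldots,n\}$ having exactly one of the edges $(i,i+1)$, $(i+1,i)$ for each $0\le i<n$ and no other edges. A path in $X$ is a map $f\colon I_n\to X$ with $I_n\in\mathcal{I}_n$; it is reduced if it is a homomorphism, and is a loop if $f(0)=f(n)$. A subpath of a reduced path $f\colon I\to X$, $I\in\mathcal{I}_n$, is its restriction to the induced subgraph of $I$ on $\{k,k+1,\ldots,l\}$ for some $0\le k\le l\le n$. A subgraph is represented by a path if it is the image of that path. For a subgraph $A$ of $X$, the complement $X-A$ is the smallest subgraph of $X$ with $X=(X-A)\cup A$; explicitly $E(X-A)=E(X)-E(A)$, and $V(X-A)$ is $V(X)-V(A)$ together with all endpoints of edges in $E(X-A)$. Subdivision: let $L$ be a subgraph of $X$ represented by a reduced loop. A subdivision of $L$ consists of two subgraphs $L_1,L_2$ of $X$ represented by reduced loops such that $L_1\cap L_2$ is represented by subpaths of $L_1$, $L_2$ and $L=L_1\cup L_2-L_1\cap L_2$. Subdividing iteratively, the resulting subgraphs $L_1,\ldots,L_n$ represented by reduced loops are also called a subdivision of $L$. $\Gamma_1$ is the directed graph with vertices $u_0=v_0$, $u_1=v_1$ and edge $(u_0,u_1)$. For $r\ge2$, $\Gamma_r$ has vertices $u_0=v_0,u_1,v_1,\ldots,u_{r-1},v_{r-1},u_r=v_r$ and edges $(u_i,u_{i+1}),(v_i,v_{i+1})$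 for $0\le i\le r-1$. A degenerate $\Gamma_r$ in $X$ is the image of a map $\Gamma_r\to X$ (obtained from $\Gamma_r$ by contracting some edges and identifying some vertices). Separability: for $1\le r<\infty$, a pair $(X,Y)$ of directed graphs is $r$-separable if any degenerate $\Gamma_r$ in $X\cup Y$ is subdivided into degenerate $\Gamma_r$'s, each of which is in either $X$ or $Y$ (no subdivision is needed if it already lies in $X$ or $Y$). The pair is $\infty$-separable if for any $1\le r<\infty$, any degenerate $\Gamma_r$ in $X\cup Y$ is subdivided into degenerate $\Gamma_s$'s for some $s\ge r$, possibly depending on the given degenerate $\Gamma_r$, each of which is in either $X$ or $Y$. *)

theory Defs
  imports
    "HOL-Library.Extended_Nat"
    "Graph_Theory.Pair_Digraph"
    "Graph_Theory.Vertex_Walk"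
begin

section \<open>Directed graphs\<close>

text \<open>
  A directed graph is a pair digraph satisfying \<^locale>\<open>pair_loopfree_digraph\<close>; it may be
  infinite or empty.
\<close>

definition graph_un :: "'a pair_pre_digraph \<Rightarrow> 'a pair_pre_digraph \<Rightarrow> 'a pair_pre_digraph" where
  "graph_un X Y = \<lparr> pverts = pverts X \<union> pverts Y, parcs = parcs X \<union> parcs Y \<rparr>"

definition graph_int :: "'a pair_pre_digraph \<Rightarrow> 'a pair_pre_digraph \<Rightarrow> 'a pair_pre_digraph" where
  "graph_int X Y = \<lparr> pverts = pverts X \<inter> pverts Y, parcs = parcs X \<inter> parcs Y \<rparr>"

text \<open>The complement keeps the endpoints of the remaining edges, so it is again a graph.\<close>

definition graph_compl :: "'a pair_pre_digraph \<Rightarrow> 'a pair_pre_digraph \<Rightarrow> 'a pair_pre_digraph" where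
  "graph_compl X A =
     \<lparr> pverts = (pverts X - pverts A) \<union> fst ` (parcs X - parcs A) \<union> snd ` (parcs X - parcs A),
       parcs = parcs X - parcs A \<rparr>"

definition graph_map :: "'a pair_pre_digraph \<Rightarrow> 'b pair_pre_digraph \<Rightarrow> ('a \<Rightarrow> 'b) \<Rightarrow> bool" where
  "graph_map X Y f \<longleftrightarrow>
     f ` pverts X \<subseteq> pverts Y \<and> (\<forall>(x, y) \<in> parcs X. (f x, f y) \<in> parcs Y \<or> f x = f y)"

definition graph_hom :: "'a pair_pre_digraph \<Rightarrow> 'b pair_pre_digraph \<Rightarrow> ('a \<Rightarrow> 'b) \<Rightarrow> bool" where
  "graph_hom X Y f \<longleftrightarrow>
     f ` pverts X \<subseteq> pverts Y \<and> (\<forall>(x, y) \<in> parcs X. (f x, f y) \<in> parcs Y)"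

text \<open>The image of a map; contracted edges contribute only their vertex.\<close>

definition graph_image :: "'a pair_pre_digraph \<Rightarrow> ('a \<Rightarrow> 'b) \<Rightarrow> 'b pair_pre_digraph" where
  "graph_image X f =
     \<lparr> pverts = f ` pverts X, parcs = {(f x, f y) | x y. (x, y) \<in> parcs X \<and> f x \<noteq> f y} \<rparr>"

section \<open>Distance and the simplicial sets \<open>N\<^sup>r(X)\<close>\<close>

text \<open>The infimum over the empty set is \<open>\<infinity>\<close>.\<close>

definition ddist :: "'a pair_pre_digraph \<Rightarrow> 'a \<Rightarrow> 'a \<Rightarrow> enat" where
  "ddist X x y =
     (INF p \<in> {p. vwalk p (with_proj X) \<and> hd p = x \<and> last p = y}. enat (vwalk_length p))"

definition tuple_length :: "'a pair_pre_digraph \<Rightarrow> 'a list \<Rightarrow> enat" where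
  "tuple_length X xs = (\<Sum>i < length xs - 1. ddist X (xs ! i) (xs ! Suc i))"

text \<open>
  \<open>nerve r X n\<close> is the set of \<open>n\<close>-simplices, an \<open>n\<close>-simplex \<open>(x\<^sub>0, \<dots>, x\<^sub>n)\<close> being a list of length
  \<open>n + 1\<close>. Faces and degeneracies delete and repeat list entries.
\<close>

definition nerve :: "enat \<Rightarrow> 'a pair_pre_digraph \<Rightarrow> nat \<Rightarrow> 'a list set" where
  "nerve r X n =
     {xs. length xs = Suc n \<and> set xs \<subseteq> pverts X \<and>
          (if r = \<infinity> then tuple_length X xs < \<infinity> else tuple_length X xs \<le> r)}"

section \<open>Groupoids\<close>

text \<open>Composition is written in diagrammatic order: \<open>Comp G f g\<close> is \<open>f\<close> followed by \<open>g\<close>.\<close>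

record ('o, 'm) gpd =
  Obj :: "'o set"
  Arr :: "'m set"
  Dom :: "'m \<Rightarrow> 'o"
  Cod :: "'m \<Rightarrow> 'o"
  Ident :: "'o \<Rightarrow> 'm"
  Comp :: "'m \<Rightarrow> 'm \<Rightarrow> 'm"

locale groupoid =
  fixes G :: "('o, 'm) gpd"
  assumes Dom_in: "f \<in> Arr G \<Longrightarrow> Dom G f \<in> Obj G"
    and Cod_in: "f \<in> Arr G \<Longrightarrow> Cod G f \<in> Obj G"
    and Ident_in: "x \<in> Obj G \<Longrightarrow> Ident G x \<in> Arr G"
    and Dom_Ident: "x \<in> Obj G \<Longrightarrow> Dom G (Ident G x) = x"
    and Cod_Ident: "x \<in> Obj G \<Longrightarrow> Cod G (Ident G x) = x"
    and Comp_in: "\<lbrakk>f \<in> Arr G; g \<in> Arr G; Cod G f = Dom G g\<rbrakk> \<Longrightarrow> Comp G f g \<in> Arr G"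
    and Dom_Comp: "\<lbrakk>f \<in> Arr G; g \<in> Arr G; Cod G f = Dom G g\<rbrakk> \<Longrightarrow> Dom G (Comp G f g) = Dom G f"
    and Cod_Comp: "\<lbrakk>f \<in> Arr G; g \<in> Arr G; Cod G f = Dom G g\<rbrakk> \<Longrightarrow> Cod G (Comp G f g) = Cod G g"
    and Comp_assoc: "\<lbrakk>f \<in> Arr G; g \<in> Arr G; h \<in> Arr G; Cod G f = Dom G g; Cod G g = Dom G h\<rbrakk> \<Longrightarrow>
          Comp G (Comp G f g) h = Comp G f (Comp G g h)"
    and Ident_left: "f \<in> Arr G \<Longrightarrow> Comp G (Ident G (Dom G f)) f = f"
    and Ident_right: "f \<in> Arr G \<Longrightarrow> Comp G f (Ident G (Cod G f)) = f"
    and inverse: "f \<in> Arr G \<Longrightarrow> \<exists>g \<in> Arr G. Dom G g = Cod G f \<and> Cod G g = Dom G f \<and>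
          Comp G f g = Ident G (Dom G f) \<and> Comp G g f = Ident G (Cod G f)"

record ('o, 'm, 'p, 'n) gpd_fun =
  on_obj :: "'o \<Rightarrow> 'p"
  on_arr :: "'m \<Rightarrow> 'n"

definition gpd_functor ::
    "('o, 'm) gpd \<Rightarrow> ('p, 'n) gpd \<Rightarrow> ('o, 'm, 'p, 'n) gpd_fun \<Rightarrow> bool" where
  "gpd_functor G H F \<longleftrightarrow>
     (\<forall>x \<in> Obj G. on_obj F x \<in> Obj H \<and> on_arr F (Ident G x) = Ident H (on_obj F x)) \<and>
     (\<forall>f \<in> Arr G. on_arr F f \<in> Arr H \<and>
        Dom H (on_arr F f) = on_obj F (Dom G f) \<and> Cod H (on_arr F f) = on_obj F (Cod G f)) \<and>
     (\<forall>f \<in> Arr G. \<forall>g \<in> Arr G. Cod G f = Dom G g \<longrightarrow>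
        on_arr F (Comp G f g) = Comp H (on_arr F f) (on_arr F g))"

definition gpd_fun_comp ::
    "('p, 'n, 'q, 'k) gpd_fun \<Rightarrow> ('o, 'm, 'p, 'n) gpd_fun \<Rightarrow> ('o, 'm, 'q, 'k) gpd_fun" where
  "gpd_fun_comp K F = \<lparr> on_obj = on_obj K \<circ> on_obj F, on_arr = on_arr K \<circ> on_arr F \<rparr>"

text \<open>Functors are total functions at the type level, so they are compared on their source only.\<close>

definition gpd_fun_eq ::
    "('o, 'm) gpd \<Rightarrow> ('o, 'm, 'p, 'n) gpd_fun \<Rightarrow> ('o, 'm, 'p, 'n) gpd_fun \<Rightarrow> bool" where
  "gpd_fun_eq G F F' \<longleftrightarrow>
     (\<forall>x \<in> Obj G. on_obj F x = on_obj F' x) \<and> (\<forall>f \<in> Arr G. on_arr F f = on_arr F' f)"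

text \<open>
  The square with sides \<open>i : A \<rightarrow> B\<close>, \<open>j : A \<rightarrow> C\<close>, \<open>h : B \<rightarrow> P\<close>, \<open>k : C \<rightarrow> P\<close> is commutative and has
  the universal property with respect to all test groupoids with objects in \<open>'t\<close> and arrows in
  \<open>'u\<close>. A formula of HOL cannot quantify over types; a theorem with these two types left as type
  variables asserts the universal property for all test groupoids.
\<close>

definition gpd_pushout ::
    "'t itself \<Rightarrow> 'u itself \<Rightarrow>
     ('oa, 'ma) gpd \<Rightarrow> ('ob, 'mb) gpd \<Rightarrow> ('oc, 'mc) gpd \<Rightarrow> ('op, 'mp) gpd \<Rightarrow>
     ('oa, 'ma, 'ob, 'mb) gpd_fun \<Rightarrow> ('oa, 'ma, 'oc, 'mc) gpd_fun \<Rightarrow>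
     ('ob, 'mb, 'op, 'mp) gpd_fun \<Rightarrow> ('oc, 'mc, 'op, 'mp) gpd_fun \<Rightarrow> bool" where
  "gpd_pushout _ _ A B C P i j h k \<longleftrightarrow>
     groupoid A \<and> groupoid B \<and> groupoid C \<and> groupoid P \<and>
     gpd_functor A B i \<and> gpd_functor A C j \<and> gpd_functor B P h \<and> gpd_functor C P k \<and>
     gpd_fun_eq A (gpd_fun_comp h i) (gpd_fun_comp k j) \<and>
     (\<forall>(T :: ('t, 'u) gpd) F K.
        groupoid T \<and> gpd_functor B T F \<and> gpd_functor C T K \<and>
        gpd_fun_eq A (gpd_fun_comp F i) (gpd_fun_comp K j) \<longrightarrow>
        (\<exists>H. gpd_functor P T H \<and>
             gpd_fun_eq B (gpd_fun_comp H h) F \<and> gpd_fun_eq C (gpd_fun_comp H k) K \<and>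
             (\<forall>H'. gpd_functor P T H' \<and>
                   gpd_fun_eq B (gpd_fun_comp H' h) F \<and> gpd_fun_eq C (gpd_fun_comp H' k) K \<longrightarrow>
                   gpd_fun_eq P H' H)))"

section \<open>The edge-path groupoid\<close>

text \<open>
  \<open>N\<close> is a simplicial set whose \<open>n\<close>-simplices are \<open>(n + 1)\<close>-tuples. \<open>Fwd x y\<close> stands for the
  generator \<open>(x, y) : x \<rightarrow> y\<close> and \<open>Bwd x y\<close> for its formal inverse \<open>y \<rightarrow> x\<close>.
\<close>

datatype 'a step = Fwd 'a 'a | Bwd 'a 'a

fun edge_path :: "(nat \<Rightarrow> 'a list set) \<Rightarrow> 'a \<Rightarrow> 'a step list \<Rightarrow> 'a \<Rightarrow> bool" where
  "edge_path N x [] y \<longleftrightarrow> x = y \<and> [x] \<in> N 0"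
| "edge_path N x (Fwd a b # w) y \<longleftrightarrow> [a, b] \<in> N 1 \<and> x = a \<and> edge_path N b w y"
| "edge_path N x (Bwd a b # w) y \<longleftrightarrow> [a, b] \<in> N 1 \<and> x = b \<and> edge_path N a w y"

inductive edge_move :: "(nat \<Rightarrow> 'a list set) \<Rightarrow> 'a step list \<Rightarrow> 'a step list \<Rightarrow> bool"
  for N where
  cancel_right: "[x, y] \<in> N 1 \<Longrightarrow> edge_move N (p @ [Fwd x y, Bwd x y] @ q) (p @ q)"
| cancel_left: "[x, y] \<in> N 1 \<Longrightarrow> edge_move N (p @ [Bwd x y, Fwd x y] @ q) (p @ q)"
| degenerate: "[x] \<in> N 0 \<Longrightarrow> edge_move N (p @ [Fwd x x] @ q) (p @ q)"
| triangle: "[x, y, z] \<in> N 2 \<Longrightarrow> edge_move N (p @ [Fwd x z] @ q) (p @ [Fwd x y, Fwd y z] @ q)"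

definition edge_homotopic ::
    "(nat \<Rightarrow> 'a list set) \<Rightarrow> 'a \<Rightarrow> 'a \<Rightarrow> 'a step list \<Rightarrow> 'a step list \<Rightarrow> bool" where
  "edge_homotopic N x y =
     equivclp (\<lambda>w w'. edge_path N x w y \<and> edge_path N x w' y \<and> edge_move N w w')"

text \<open>An arrow is its source, a homotopy class of edge paths, and its target.\<close>

type_synonym 'a edge_arrow = "'a \<times> 'a step list set \<times> 'a"

definition edge_class ::
    "(nat \<Rightarrow> 'a list set) \<Rightarrow> 'a \<Rightarrow> 'a \<Rightarrow> 'a step list \<Rightarrow> 'a edge_arrow" where
  "edge_class N x y w = (x, {w'. edge_homotopic N x y w w'}, y)"

definition edge_path_groupoid :: "(nat \<Rightarrow> 'a list set) \<Rightarrow> ('a, 'a edge_arrow) gpd" where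
  "edge_path_groupoid N =
     \<lparr> Obj = {x. [x] \<in> N 0},
       Arr = {edge_class N x y w | x y w. edge_path N x w y},
       Dom = (\<lambda>(x, c, y). x),
       Cod = (\<lambda>(x, c, y). y),
       Ident = (\<lambda>x. edge_class N x x []),
       Comp = (\<lambda>(x, c, y) (y', c', z).
         (x, {w. \<exists>u \<in> c. \<exists>v \<in> c'. edge_homotopic N x z (u @ v) w}, z)) \<rparr>"

text \<open>The functor to the edge-path groupoid of \<open>N\<close> that sends \<open>(x, y)\<close> to \<open>(f x, f y)\<close>.\<close>

definition edge_path_functor ::
    "(nat \<Rightarrow> 'b list set) \<Rightarrow> ('a \<Rightarrow> 'b) \<Rightarrow> ('a, 'a edge_arrow, 'b, 'b edge_arrow) gpd_fun" where
  "edge_path_functor N f =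
     \<lparr> on_obj = f,
       on_arr = (\<lambda>(x, c, y).
         (f x, {w. \<exists>u \<in> c. edge_homotopic N (f x) (f y) (map (map_step f) u) w}, f y)) \<rparr>"

definition fund_groupoid :: "enat \<Rightarrow> 'a pair_pre_digraph \<Rightarrow> ('a, 'a edge_arrow) gpd" where
  "fund_groupoid r X = edge_path_groupoid (nerve r X)"

text \<open>
  \<open>fund_map r Y f\<close> is the functor from the \<open>r\<close>-fundamental groupoid of any \<open>X\<close> to that of \<open>Y\<close>
  induced by a map \<open>f : X \<rightarrow> Y\<close>; its definition depends on \<open>X\<close> only through the type. An inclusion
  is the case \<open>f = id\<close>.
\<close>

definition fund_map ::
    "enat \<Rightarrow> 'b pair_pre_digraph \<Rightarrow> ('a \<Rightarrow> 'b) \<Rightarrow> ('a, 'a edge_arrow, 'b, 'b edge_arrow) gpd_fun" where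
  "fund_map r Y f = edge_path_functor (nerve r Y) f"

section \<open>Paths, loops and subdivisions\<close>

definition line_graphs :: "nat \<Rightarrow> nat pair_pre_digraph set" where
  "line_graphs n =
     {I. pverts I = {0..n} \<and>
         (\<forall>i < n. ((i, Suc i) \<in> parcs I) \<noteq> ((Suc i, i) \<in> parcs I)) \<and>
         parcs I \<subseteq> (\<Union>i < n. {(i, Suc i), (Suc i, i)})}"

text \<open>A reduced path is a path (a map from a line graph) that is a homomorphism.\<close>

definition reduced_path ::
    "'a pair_pre_digraph \<Rightarrow> nat \<Rightarrow> nat pair_pre_digraph \<Rightarrow> (nat \<Rightarrow> 'a) \<Rightarrow> bool" where
  "reduced_path X n I f \<longleftrightarrow> I \<in> line_graphs n \<and> graph_hom I X f"

definition reduced_loop ::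
    "'a pair_pre_digraph \<Rightarrow> nat \<Rightarrow> nat pair_pre_digraph \<Rightarrow> (nat \<Rightarrow> 'a) \<Rightarrow> bool" where
  "reduced_loop X n I f \<longleftrightarrow> reduced_path X n I f \<and> f 0 = f n"

definition induced_segment :: "nat pair_pre_digraph \<Rightarrow> nat \<Rightarrow> nat \<Rightarrow> nat pair_pre_digraph" where
  "induced_segment I k l =
     \<lparr> pverts = pverts I \<inter> {k..l}, parcs = parcs I \<inter> ({k..l} \<times> {k..l}) \<rparr>"

definition represented_by_subpath ::
    "'a pair_pre_digraph \<Rightarrow> nat \<Rightarrow> nat pair_pre_digraph \<Rightarrow> (nat \<Rightarrow> 'a) \<Rightarrow> bool" where
  "represented_by_subpath A n I f \<longleftrightarrow>
     (\<exists>k l. k \<le> l \<and> l \<le> n \<and> A = graph_image (induced_segment I k l) f)"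

definition represented_by_reduced_loop ::
    "'a pair_pre_digraph \<Rightarrow> 'a pair_pre_digraph \<Rightarrow> bool" where
  "represented_by_reduced_loop X L \<longleftrightarrow> (\<exists>n I f. reduced_loop X n I f \<and> L = graph_image I f)"

text \<open>
  The reduced loops representing \<open>L\<^sub>1\<close> and \<open>L\<^sub>2\<close> are not part of the subgraphs; a subdivision asks
  for some choice of loops that have the intersection as the image of a subpath.
\<close>

definition subdivides_into_two ::
    "'a pair_pre_digraph \<Rightarrow> 'a pair_pre_digraph \<Rightarrow> 'a pair_pre_digraph \<Rightarrow> 'a pair_pre_digraph \<Rightarrow> bool"
  where
  "subdivides_into_two X L L\<^sub>1 L\<^sub>2 \<longleftrightarrow>
     represented_by_reduced_loop X L \<and>
     (\<exists>n\<^sub>1 I\<^sub>1 f\<^sub>1. reduced_loop X n\<^sub>1 I\<^sub>1 f\<^sub>1 \<and> L\<^sub>1 = graph_image I\<^sub>1 f\<^sub>1 \<and>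
        represented_by_subpath (graph_int L\<^sub>1 L\<^sub>2) n\<^sub>1 I\<^sub>1 f\<^sub>1) \<and>
     (\<exists>n\<^sub>2 I\<^sub>2 f\<^sub>2. reduced_loop X n\<^sub>2 I\<^sub>2 f\<^sub>2 \<and> L\<^sub>2 = graph_image I\<^sub>2 f\<^sub>2 \<and>
        represented_by_subpath (graph_int L\<^sub>1 L\<^sub>2) n\<^sub>2 I\<^sub>2 f\<^sub>2) \<and>
     L = graph_compl (graph_un L\<^sub>1 L\<^sub>2) (graph_int L\<^sub>1 L\<^sub>2)"

text \<open>Iterated subdivision; \<open>[L]\<close> is the case where no subdivision is performed.\<close>

inductive subdivision ::
    "'a pair_pre_digraph \<Rightarrow> 'a pair_pre_digraph \<Rightarrow> 'a pair_pre_digraph list \<Rightarrow> bool"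
  for X L where
  none: "represented_by_reduced_loop X L \<Longrightarrow> subdivision X L [L]"
| step: "\<lbrakk>subdivision X L (Ms @ M # Ms'); subdivides_into_two X M M\<^sub>1 M\<^sub>2\<rbrakk> \<Longrightarrow>
    subdivision X L (Ms @ M\<^sub>1 # M\<^sub>2 # Ms')"

section \<open>The graphs \<open>\<Gamma>\<^sub>r\<close> and separability\<close>

text \<open>
  The identifications \<open>u\<^sub>0 = v\<^sub>0\<close> and \<open>u\<^sub>r = v\<^sub>r\<close> are made by using only the \<open>U\<close>-names of these two
  vertices. For \<open>r = 1\<close> the two sides coincide and a single edge remains.
\<close>

datatype gamma_vertex = U nat | V nat

definition gamma_u :: "nat \<Rightarrow> gamma_vertex" where
  "gamma_u i = U i"

definition gamma_v :: "nat \<Rightarrow> nat \<Rightarrow> gamma_vertex" where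
  "gamma_v r i = (if i = 0 \<or> i = r then U i else V i)"

definition Gamma_graph :: "nat \<Rightarrow> gamma_vertex pair_pre_digraph" where
  "Gamma_graph r =
     \<lparr> pverts = gamma_u ` {0..r} \<union> gamma_v r ` {0..r},
       parcs = {(gamma_u i, gamma_u (Suc i)) | i. i < r} \<union>
               {(gamma_v r i, gamma_v r (Suc i)) | i. i < r} \<rparr>"

definition degenerate_Gamma :: "nat \<Rightarrow> 'a pair_pre_digraph \<Rightarrow> 'a pair_pre_digraph \<Rightarrow> bool" where
  "degenerate_Gamma r X L \<longleftrightarrow>
     (\<exists>f. graph_map (Gamma_graph r) X f \<and> L = graph_image (Gamma_graph r) f)"

definition separable_fin :: "nat \<Rightarrow> 'a pair_pre_digraph \<Rightarrow> 'a pair_pre_digraph \<Rightarrow> bool" where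
  "separable_fin r X Y \<longleftrightarrow>
     (\<forall>L. degenerate_Gamma r (graph_un X Y) L \<longrightarrow>
        (\<exists>Ls. subdivision (graph_un X Y) L Ls \<and>
              (\<forall>M \<in> set Ls. degenerate_Gamma r X M \<or> degenerate_Gamma r Y M)))"

definition separable_inf :: "'a pair_pre_digraph \<Rightarrow> 'a pair_pre_digraph \<Rightarrow> bool" where
  "separable_inf X Y \<longleftrightarrow>
     (\<forall>r \<ge> 1. \<forall>L. degenerate_Gamma r (graph_un X Y) L \<longrightarrow>
        (\<exists>s \<ge> r. \<exists>Ls. subdivision (graph_un X Y) L Ls \<and>
              (\<forall>M \<in> set Ls. degenerate_Gamma s X M \<or> degenerate_Gamma s Y M)))"

definition separable :: "enat \<Rightarrow> 'a pair_pre_digraph \<Rightarrow> 'a pair_pre_digraph \<Rightarrow> bool" where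
  "separable r X Y \<longleftrightarrow> (case r of enat k \<Rightarrow> separable_fin k X Y | \<infinity> \<Rightarrow> separable_inf X Y)"

end

theory Submission
  imports Defs
begin

text \<open>
  The groupoid \<open>\<Pi>\<^sub>1\<^sup>r(Z)\<close> is generated by the arcs of \<open>Z\<close>, and its relations say that two directed walks
  of length at most \<open>r\<close> with the same endpoints represent the same arrow. Functors out of the
  groupoids of \<open>X\<close> and \<open>Y\<close> that agree on the groupoid of \<open>X \<inter> Y\<close> therefore give a consistent
  labelling of the arcs of \<open>X \<union> Y\<close> by arrows of the test groupoid. Uniqueness of the induced
  functor is clear, since the arcs generate (\<open>functor_determined_by_arcs\<close>). Existence amounts to
  showing that parallel walks of length at most \<open>r\<close> in \<open>X \<union> Y\<close> have equal values, for then the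
  value of a 1-simplex \<open>(x, y)\<close> can be defined by any such walk from \<open>x\<close> to \<open>y\<close>
  (\<open>functor_of_arc_labelling\<close>).

  Two parallel walks form a degenerate \<open>\<Gamma>\<^sub>k\<close> (\<open>parallel_walks_degenerate_Gamma\<close>), which separability
  subdivides into degenerate \<open>\<Gamma>\<^sub>s\<close>'s lying in \<open>X\<close> or in \<open>Y\<close>. The difficulty is that a subdivision is
  a statement about subgraphs, each of which may be represented by many loops, so one cannot simply
  follow the value of one particular loop. Call a subgraph balanced if the labelling admits a potential on it,
  which for a connected subgraph means that all closed edge paths in it have trivial value. This property
  belongs to the subgraph and behaves well in three respects. A degenerate \<open>\<Gamma>\<^sub>s\<close> in
  \<open>X\<close> or \<open>Y\<close> is balanced, however its vertices are identified: the 1-simplices from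
  its initial vertex provide a potential (\<open>balanced_degenerate_Gamma\<close>). Two balanced graphs with
  nonempty connected intersection have balanced union, because potentials on a connected graph differ by one
  arrow (\<open>balanced_union\<close>). Finally, subgraphs of balanced graphs are balanced. So balance passes
  from the pieces of a subdivision to the subdivided graph (\<open>balanced_subdivision\<close>), and in a
  balanced graph parallel walks have equal values (\<open>balanced_parallel_walks\<close>).
\<close>

section \<open>Inverses and functors of groupoids\<close>

definition gpd_inv :: "('o, 'm) gpd \<Rightarrow> 'm \<Rightarrow> 'm" where
  "gpd_inv G f = (SOME g. g \<in> Arr G \<and> Dom G g = Cod G f \<and> Cod G g = Dom G f \<and>
     Comp G f g = Ident G (Dom G f) \<and> Comp G g f = Ident G (Cod G f))"

context groupoid
begin

lemmas gpd_simps = Dom_in Cod_in Ident_in Dom_Ident Cod_Ident Comp_in Dom_Comp Cod_Comp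

lemma gpd_inv:
  assumes "f \<in> Arr G"
  shows "gpd_inv G f \<in> Arr G" "Dom G (gpd_inv G f) = Cod G f" "Cod G (gpd_inv G f) = Dom G f"
    "Comp G f (gpd_inv G f) = Ident G (Dom G f)" "Comp G (gpd_inv G f) f = Ident G (Cod G f)"
proof -
  have "\<exists>g. g \<in> Arr G \<and> Dom G g = Cod G f \<and> Cod G g = Dom G f \<and>
      Comp G f g = Ident G (Dom G f) \<and> Comp G g f = Ident G (Cod G f)"
    using inverse[OF assms] by blast
  from someI_ex[OF this, folded gpd_inv_def]
  show "gpd_inv G f \<in> Arr G" "Dom G (gpd_inv G f) = Cod G f" "Cod G (gpd_inv G f) = Dom G f"
    "Comp G f (gpd_inv G f) = Ident G (Dom G f)" "Comp G (gpd_inv G f) f = Ident G (Cod G f)"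
    by blast+
qed

lemma inv_comp_cancel:
  assumes "f \<in> Arr G" "g \<in> Arr G" "Cod G f = Dom G g"
  shows "Comp G (gpd_inv G f) (Comp G f g) = g"
  using assms gpd_inv[of f] Comp_assoc[of "gpd_inv G f" f g] Ident_left[of g] by simp

lemma comp_inv_cancel:
  assumes "f \<in> Arr G" "g \<in> Arr G" "Dom G f = Dom G g"
  shows "Comp G f (Comp G (gpd_inv G f) g) = g"
  using assms gpd_inv[of f] Comp_assoc[of f "gpd_inv G f" g] Ident_left[of g] by simp

lemma comp_left_cancel:
  assumes "f \<in> Arr G" "g \<in> Arr G" "h \<in> Arr G" "Cod G f = Dom G g" "Cod G f = Dom G h"
    and "Comp G f g = Comp G f h"
  shows "g = h"
  using assms inv_comp_cancel by metis

lemma comp_right_cancel: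
  assumes "f \<in> Arr G" "g \<in> Arr G" "h \<in> Arr G" "Cod G f = Dom G h" "Cod G g = Dom G h"
    and "Comp G f h = Comp G g h"
  shows "f = g"
proof -
  have "Comp G (Comp G k h) (gpd_inv G h) = k" if "k \<in> Arr G" "Cod G k = Dom G h" for k
    using that assms(3) gpd_inv[of h] Comp_assoc[of k h "gpd_inv G h"] Ident_right[of k] by simp
  then show ?thesis using assms by metis
qed

lemma gpd_inv_unique:
  assumes "f \<in> Arr G" "g \<in> Arr G" "Cod G f = Dom G g" "Comp G f g = Ident G (Dom G f)"
  shows "g = gpd_inv G f"
  using assms comp_left_cancel[of f g "gpd_inv G f"] gpd_inv[of f] by simp

end

lemma gpd_functorD:
  assumes "gpd_functor G H F"
  shows gpd_functor_obj: "x \<in> Obj G \<Longrightarrow> on_obj F x \<in> Obj H"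
    and gpd_functor_Ident: "x \<in> Obj G \<Longrightarrow> on_arr F (Ident G x) = Ident H (on_obj F x)"
    and gpd_functor_arr: "f \<in> Arr G \<Longrightarrow> on_arr F f \<in> Arr H"
    and gpd_functor_Dom: "f \<in> Arr G \<Longrightarrow> Dom H (on_arr F f) = on_obj F (Dom G f)"
    and gpd_functor_Cod: "f \<in> Arr G \<Longrightarrow> Cod H (on_arr F f) = on_obj F (Cod G f)"
    and gpd_functor_Comp: "f \<in> Arr G \<Longrightarrow> g \<in> Arr G \<Longrightarrow> Cod G f = Dom G g \<Longrightarrow>
      on_arr F (Comp G f g) = Comp H (on_arr F f) (on_arr F g)"
  using assms by (simp_all add: gpd_functor_def)

lemma functor_inv:
  assumes "groupoid G" "groupoid H" "gpd_functor G H F" "f \<in> Arr G"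
  shows "on_arr F (gpd_inv G f) = gpd_inv H (on_arr F f)"
proof -
  interpret G: groupoid G by fact
  interpret H: groupoid H by fact
  have "on_arr F (Comp G f (gpd_inv G f)) = on_arr F (Ident G (Dom G f))"
    using G.gpd_inv[OF assms(4)] by simp
  moreover have "on_arr F (Ident G (Dom G f)) = Ident H (Dom H (on_arr F f))"
    using assms(3,4) G.Dom_in unfolding gpd_functor_def by metis
  moreover have "on_arr F (Comp G f (gpd_inv G f)) = Comp H (on_arr F f) (on_arr F (gpd_inv G f))"
    using assms(3,4) G.gpd_inv[OF assms(4)] unfolding gpd_functor_def by metis
  ultimately show ?thesis
    using assms(3,4) G.gpd_inv[OF assms(4)]
    by (intro H.gpd_inv_unique) (simp_all add: gpd_functor_def)
qed

section \<open>Edge paths up to homotopy\<close>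

text \<open>
  The edge-path groupoid sees only the simplices of dimension at most two; all that is needed of
  them is that the endpoints of a 1-simplex are 0-simplices.
\<close>

locale edge_complex =
  fixes N :: "nat \<Rightarrow> 'a list set"
  assumes face1: "[x, y] \<in> N 1 \<Longrightarrow> [x] \<in> N 0"
    and face0: "[x, y] \<in> N 1 \<Longrightarrow> [y] \<in> N 0"
begin

lemmas faces = face0[unfolded One_nat_def] face1[unfolded One_nat_def]

lemma edge_path_ends: "edge_path N x w y \<Longrightarrow> [x] \<in> N 0 \<and> [y] \<in> N 0"
proof (induction w arbitrary: x)
  case (Cons st w)
  then show ?case by (cases st) (auto dest: faces)
qed simp

lemma edge_path_append:
  "edge_path N x (u @ v) z \<longleftrightarrow> (\<exists>y. edge_path N x u y \<and> edge_path N y v z)"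
proof (induction u arbitrary: x)
  case Nil
  then show ?case using edge_path_ends[of x v z] by auto
next
  case (Cons s u)
  then show ?case by (cases s) auto
qed

end

lemma edge_homotopic_refl [simp]: "edge_homotopic N x y w w"
  by (simp add: edge_homotopic_def)

lemma edge_homotopic_sym: "edge_homotopic N x y w w' \<Longrightarrow> edge_homotopic N x y w' w"
  unfolding edge_homotopic_def by (rule equivclp_sym)

lemma edge_homotopic_trans [trans]:
  "edge_homotopic N x y w w' \<Longrightarrow> edge_homotopic N x y w' w'' \<Longrightarrow> edge_homotopic N x y w w''"
  unfolding edge_homotopic_def by (rule equivclp_trans)

lemma edge_move_homotopic:
  "edge_move N w w' \<Longrightarrow> edge_path N x w y \<Longrightarrow> edge_path N x w' y \<Longrightarrow> edge_homotopic N x y w w'"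
  unfolding edge_homotopic_def by (rule r_into_equivclp) (intro conjI)

text \<open>
  Edge homotopy is an equivalence closure, so an induction has to treat a move in both directions.
\<close>

lemma edge_homotopic_induct [consumes 1, case_names refl forward backward]:
  assumes "edge_homotopic N x y w w'"
    and "P w"
    and "\<And>u v. P u \<Longrightarrow> edge_path N x u y \<Longrightarrow> edge_path N x v y \<Longrightarrow> edge_move N u v \<Longrightarrow> P v"
    and "\<And>u v. P u \<Longrightarrow> edge_path N x u y \<Longrightarrow> edge_path N x v y \<Longrightarrow> edge_move N v u \<Longrightarrow> P v"
  shows "P w'"
  using assms(1) unfolding edge_homotopic_def
proof (induction rule: equivclp_induct)
  case base
  show ?case by (rule assms(2))
next
  case (step u v)
  then show ?case using assms(3,4)[of u v] by blast
qed

lemma edge_homotopic_path: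
  "edge_homotopic N x y w w' \<Longrightarrow> edge_path N x w y \<Longrightarrow> edge_path N x w' y"
  by (induction rule: edge_homotopic_induct) auto

lemma edge_move_context:
  assumes "edge_move N u v"
  shows "edge_move N (p @ u @ q) (p @ v @ q)"
  using assms
proof cases
  case (cancel_right x y p' q')
  then show ?thesis using edge_move.cancel_right[of x y N "p @ p'" "q' @ q"] by simp
next
  case (cancel_left x y p' q')
  then show ?thesis using edge_move.cancel_left[of x y N "p @ p'" "q' @ q"] by simp
next
  case (degenerate x p' q')
  then show ?thesis using edge_move.degenerate[of x N "p @ p'" "q' @ q"] by simp
next
  case (triangle x y z p' q')
  then show ?thesis using edge_move.triangle[of x y z N "p @ p'" "q' @ q"] by simp
qed

lemma (in edge_complex) edge_homotopic_context:
  assumes "edge_homotopic N x y u v" "edge_path N x' p x" "edge_path N y q y'"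
  shows "edge_homotopic N x' y' (p @ u @ q) (p @ v @ q)"
  using assms(1)
proof (induction rule: edge_homotopic_induct)
  case refl
  show ?case by simp
next
  case (forward a b)
  then have "edge_homotopic N x' y' (p @ a @ q) (p @ b @ q)"
    using assms(2,3) by (intro edge_move_homotopic edge_move_context) (auto simp: edge_path_append)
  with forward(1) show ?case by (rule edge_homotopic_trans)
next
  case (backward a b)
  then have "edge_homotopic N x' y' (p @ b @ q) (p @ a @ q)"
    using assms(2,3) by (intro edge_move_homotopic edge_move_context) (auto simp: edge_path_append)
  with backward(1) show ?case by (metis edge_homotopic_sym edge_homotopic_trans)
qed

lemma (in edge_complex) edge_homotopic_append:
  assumes "edge_homotopic N x y u u'" "edge_homotopic N y z v v'"
    and "edge_path N x u y" "edge_path N y v z"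
  shows "edge_homotopic N x z (u @ v) (u' @ v')"
proof -
  have "[x] \<in> N 0" "[z] \<in> N 0" using assms(3,4) edge_path_ends by auto
  then have "edge_homotopic N x z (u @ v) (u' @ v)"
    using edge_homotopic_context[OF assms(1), of x "[]" v z] assms(4) by simp
  also have "edge_homotopic N x z (u' @ v) (u' @ v')"
    using edge_homotopic_context[OF assms(2), of x u' "[]" z] edge_homotopic_path[OF assms(1,3)]
      \<open>[z] \<in> N 0\<close> by simp
  finally show ?thesis .
qed

text \<open>
  Flipping every step and reversing the order gives a representative of the inverse arrow.
\<close>

fun step_flip :: "'a step \<Rightarrow> 'a step" where
  "step_flip (Fwd a b) = Bwd a b"
| "step_flip (Bwd a b) = Fwd a b"

lemma step_flip_flip [simp]: "step_flip (step_flip s) = s"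
  by (cases s) auto

context edge_complex
begin

lemma edge_path_reverse:
  "edge_path N x w y \<Longrightarrow> edge_path N y (rev (map step_flip w)) x"
proof (induction w arbitrary: x)
  case (Cons s w)
  then show ?case by (cases s) (auto simp: edge_path_append dest: faces)
qed simp

lemma edge_path_reverse_homotopic:
  "edge_path N x w y \<Longrightarrow> edge_homotopic N x x (w @ rev (map step_flip w)) []"
proof (induction w arbitrary: x)
  case (Cons s w)
  then obtain z where z: "edge_path N x [s] z" "edge_path N z w y"
    using edge_path_append[of x "[s]" w y] by auto
  let ?w' = "rev (map step_flip w)"
  have s': "edge_path N z [step_flip s] x" using edge_path_reverse[OF z(1)] by simp
  have "edge_homotopic N x x ([s] @ (w @ ?w') @ [step_flip s]) ([s] @ [] @ [step_flip s])"
    using Cons.IH[OF z(2)] z(1) s' by (rule edge_homotopic_context)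
  also have "edge_homotopic N x x ([s] @ [] @ [step_flip s]) []"
  proof (rule edge_move_homotopic)
    show "edge_move N ([s] @ [] @ [step_flip s]) []"
      using z(1) edge_move.cancel_right[of _ _ N "[]" "[]"] edge_move.cancel_left[of _ _ N "[]" "[]"]
      by (cases s) auto
    show "edge_path N x ([s] @ [] @ [step_flip s]) x"
      using z(1) s' edge_path_append[of x "[s]" "[step_flip s]" x] by auto
    show "edge_path N x [] x" using edge_path_ends[OF z(1)] by simp
  qed
  finally show ?case by simp
qed simp

end

section \<open>The edge-path groupoid and its functors\<close>

context edge_complex
begin

lemma edge_class_eq_iff:
  "edge_class N x y u = edge_class N x' y' v \<longleftrightarrow> x = x' \<and> y = y' \<and> edge_homotopic N x y u v"
proof -
  have "edge_homotopic N x y u v"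
    if "{w. edge_homotopic N x y u w} = {w. edge_homotopic N x y v w}"
  proof -
    have "v \<in> {w. edge_homotopic N x y v w}" by simp
    then show ?thesis unfolding that[symmetric] by simp
  qed
  moreover have "edge_homotopic N x y u w \<longleftrightarrow> edge_homotopic N x y v w"
    if "edge_homotopic N x y u v" for w
    using that by (metis edge_homotopic_trans edge_homotopic_sym)
  ultimately show ?thesis unfolding edge_class_def prod.inject by blast
qed

lemma edge_path_groupoid_Comp:
  assumes "edge_path N x u y" "edge_path N y v z"
  shows "Comp (edge_path_groupoid N) (edge_class N x y u) (edge_class N y z v) =
    edge_class N x z (u @ v)"
proof -
  have "{w. \<exists>u' \<in> {u'. edge_homotopic N x y u u'}. \<exists>v' \<in> {v'. edge_homotopic N y z v v'}.
      edge_homotopic N x z (u' @ v') w} = {w. edge_homotopic N x z (u @ v) w}" (is "?A = ?B")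
  proof
    show "?A \<subseteq> ?B"
      using edge_homotopic_append[OF _ _ assms] edge_homotopic_trans[of N x z "u @ v"] by blast
    show "?B \<subseteq> ?A"
      using edge_homotopic_refl[of N x y u] edge_homotopic_refl[of N y z v] by blast
  qed
  then show ?thesis by (simp add: edge_path_groupoid_def edge_class_def)
qed

lemma edge_path_groupoid_simps [simp]:
  "Obj (edge_path_groupoid N) = {x. [x] \<in> N 0}"
  "Dom (edge_path_groupoid N) (edge_class N x y w) = x"
  "Cod (edge_path_groupoid N) (edge_class N x y w) = y"
  "Ident (edge_path_groupoid N) x = edge_class N x x []"
  by (simp_all add: edge_path_groupoid_def edge_class_def)

lemma edge_class_in_Arr [intro]:
  "edge_path N x w y \<Longrightarrow> edge_class N x y w \<in> Arr (edge_path_groupoid N)"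
  by (auto simp: edge_path_groupoid_def)

lemma edge_path_groupoid_arrowE:
  assumes "f \<in> Arr (edge_path_groupoid N)"
  obtains x w y where "f = edge_class N x y w" "edge_path N x w y"
  using assms by (auto simp: edge_path_groupoid_def)

lemma edge_path_groupoid_inverse:
  assumes "edge_path N x w y"
  shows "Comp (edge_path_groupoid N) (edge_class N x y w)
      (edge_class N y x (rev (map step_flip w))) = edge_class N x x []"
  using edge_path_groupoid_Comp[OF assms edge_path_reverse[OF assms]]
    edge_path_reverse_homotopic[OF assms] by (simp add: edge_class_eq_iff)

lemma groupoid_edge_path_groupoid: "groupoid (edge_path_groupoid N)" (is "groupoid ?P")
proof -
  have append: "edge_path N x (u @ v) z" if "edge_path N x u y" "edge_path N y v z" for x u y v z
    using that edge_path_append by blast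
  note arrow = edge_path_groupoid_arrowE
  show ?thesis
  proof
    fix f assume "f \<in> Arr ?P"
    then obtain x w y where f: "f = edge_class N x y w" and w: "edge_path N x w y"
      by (rule arrow)
    show "Dom ?P f \<in> Obj ?P" "Cod ?P f \<in> Obj ?P"
      using edge_path_ends[OF w] f by auto
    have "edge_path N x [] x" "edge_path N y [] y" using edge_path_ends[OF w] by auto
    then show "Comp ?P (Ident ?P (Dom ?P f)) f = f" "Comp ?P f (Ident ?P (Cod ?P f)) = f"
      using w f edge_path_groupoid_Comp by auto
    let ?w' = "rev (map step_flip w)"
    have "map step_flip (map step_flip w) = w" by (induction w) auto
    then have "rev (map step_flip ?w') = w" by (simp add: rev_map)
    then show "\<exists>g\<in>Arr ?P. Dom ?P g = Cod ?P f \<and> Cod ?P g = Dom ?P f \<and>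
        Comp ?P f g = Ident ?P (Dom ?P f) \<and> Comp ?P g f = Ident ?P (Cod ?P f)"
      using edge_path_reverse[OF w] edge_path_groupoid_inverse[OF w]
        edge_path_groupoid_inverse[OF edge_path_reverse[OF w]]
      by (intro bexI[of _ "edge_class N y x ?w'"]) (auto simp: f)
  next
    fix x assume "x \<in> Obj ?P"
    then show "Ident ?P x \<in> Arr ?P" by auto
  next
    fix f g assume "f \<in> Arr ?P" "g \<in> Arr ?P" "Cod ?P f = Dom ?P g"
    then show "Comp ?P f g \<in> Arr ?P" "Dom ?P (Comp ?P f g) = Dom ?P f"
      "Cod ?P (Comp ?P f g) = Cod ?P g"
      by (auto elim!: arrow simp: edge_path_groupoid_Comp intro!: edge_class_in_Arr append)
  next
    fix f g h assume "f \<in> Arr ?P" "g \<in> Arr ?P" "h \<in> Arr ?P"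
      "Cod ?P f = Dom ?P g" "Cod ?P g = Dom ?P h"
    then show "Comp ?P (Comp ?P f g) h = Comp ?P f (Comp ?P g h)"
      using append by (auto elim!: arrow simp: edge_path_groupoid_Comp)
  qed simp_all
qed

end

lemma edge_move_map:
  assumes "edge_move N u v"
    and "\<And>n xs. n \<le> 2 \<Longrightarrow> xs \<in> N n \<Longrightarrow> map f xs \<in> N' n"
  shows "edge_move N' (map (map_step f) u) (map (map_step f) v)"
  using assms(1)
proof cases
  case (cancel_right x y p q)
  then show ?thesis
    using edge_move.cancel_right[of "f x" "f y" N' "map (map_step f) p" "map (map_step f) q"]
      assms(2)[of 1 "[x, y]"] by simp
next
  case (cancel_left x y p q)
  then show ?thesis
    using edge_move.cancel_left[of "f x" "f y" N' "map (map_step f) p" "map (map_step f) q"]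
      assms(2)[of 1 "[x, y]"] by simp
next
  case (degenerate x p q)
  then show ?thesis
    using edge_move.degenerate[of "f x" N' "map (map_step f) p" "map (map_step f) q"]
      assms(2)[of 0 "[x]"] by simp
next
  case (triangle x y z p q)
  then show ?thesis
    using edge_move.triangle[of "f x" "f y" "f z" N' "map (map_step f) p" "map (map_step f) q"]
      assms(2)[of 2 "[x, y, z]"] by simp
qed

lemma edge_path_map:
  assumes "edge_path N x w y" "\<And>n xs. n \<le> 2 \<Longrightarrow> xs \<in> N n \<Longrightarrow> map f xs \<in> N' n"
  shows "edge_path N' (f x) (map (map_step f) w) (f y)"
  using assms(1)
proof (induction w arbitrary: x)
  case Nil
  then show ?case using assms(2)[of 0 "[x]"] by auto
next
  case (Cons s w)
  then show ?case
  proof (cases s)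
    case (Fwd a b)
    then show ?thesis using Cons assms(2)[of 1 "[a, b]"] by simp
  next
    case (Bwd a b)
    then show ?thesis using Cons assms(2)[of 1 "[a, b]"] by simp
  qed
qed

lemma edge_homotopic_map:
  assumes "edge_homotopic N x y u v" "\<And>n xs. n \<le> 2 \<Longrightarrow> xs \<in> N n \<Longrightarrow> map f xs \<in> N' n"
  shows "edge_homotopic N' (f x) (f y) (map (map_step f) u) (map (map_step f) v)"
  using assms(1)
proof (induction rule: edge_homotopic_induct)
  case (forward a b)
  then have "edge_homotopic N' (f x) (f y) (map (map_step f) a) (map (map_step f) b)"
    using edge_move_map[of N] edge_path_map[of N] assms(2) by (intro edge_move_homotopic) blast+
  with forward(1) show ?case by (rule edge_homotopic_trans)
next
  case (backward a b)
  then have "edge_homotopic N' (f x) (f y) (map (map_step f) b) (map (map_step f) a)"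
    using edge_move_map[of N] edge_path_map[of N] assms(2) by (intro edge_move_homotopic) blast+
  with backward(1) show ?case by (metis edge_homotopic_sym edge_homotopic_trans)
qed simp

lemma edge_path_functor_class:
  assumes "\<And>n xs. n \<le> 2 \<Longrightarrow> xs \<in> N n \<Longrightarrow> map f xs \<in> N' n"
  shows "on_arr (edge_path_functor N' f) (edge_class N x y w) =
    edge_class N' (f x) (f y) (map (map_step f) w)"
proof -
  have "{v. \<exists>u \<in> {u. edge_homotopic N x y w u}.
      edge_homotopic N' (f x) (f y) (map (map_step f) u) v} =
      {v. edge_homotopic N' (f x) (f y) (map (map_step f) w) v}" (is "?A = ?B")
  proof
    show "?A \<subseteq> ?B"
    proof clarify
      fix u v
      assume "edge_homotopic N x y w u"
      then have "edge_homotopic N' (f x) (f y) (map (map_step f) w) (map (map_step f) u)"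
        by (rule edge_homotopic_map) (rule assms)
      moreover assume "edge_homotopic N' (f x) (f y) (map (map_step f) u) v"
      ultimately show "edge_homotopic N' (f x) (f y) (map (map_step f) w) v"
        by (rule edge_homotopic_trans)
    qed
    show "?B \<subseteq> ?A" by (intro subsetI CollectI bexI[of _ w]) simp_all
  qed
  then show ?thesis by (simp add: edge_path_functor_def edge_class_def)
qed

lemma on_obj_edge_path_functor [simp]: "on_obj (edge_path_functor N f) = f"
  by (simp add: edge_path_functor_def)

lemma gpd_functor_edge_path_functor:
  assumes "edge_complex N" "edge_complex N'"
    and map: "\<And>n xs. n \<le> 2 \<Longrightarrow> xs \<in> N n \<Longrightarrow> map f xs \<in> N' n"
  shows "gpd_functor (edge_path_groupoid N) (edge_path_groupoid N') (edge_path_functor N' f)"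
proof -
  interpret N: edge_complex N by fact
  interpret N': edge_complex N' by fact
  note path = edge_path_map[of N _ _ _ f N', OF _ map]
  note cls = edge_path_functor_class[of N f N', OF map]
  let ?P = "edge_path_groupoid N" and ?P' = "edge_path_groupoid N'"
  let ?F = "edge_path_functor N' f"
  show ?thesis
    unfolding gpd_functor_def
  proof (intro conjI ballI impI; (elim N.edge_path_groupoid_arrowE)?)
    fix x assume "x \<in> Obj ?P"
    then show "on_obj ?F x \<in> Obj ?P'" "on_arr ?F (Ident ?P x) = Ident ?P' (on_obj ?F x)"
      using map[of 0 "[x]"] cls[of x x "[]"] by auto
  next
    fix g h x w y x' w' y'
    assume *: "g = edge_class N x y w" "edge_path N x w y"
      "h = edge_class N x' y' w'" "edge_path N x' w' y'" "Cod ?P g = Dom ?P h"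
    then have xy: "x' = y" by simp
    have w': "edge_path N y w' y'" using *(4) xy by simp
    show "on_arr ?F (Comp ?P g h) = Comp ?P' (on_arr ?F g) (on_arr ?F h)"
      using N.edge_path_groupoid_Comp[OF *(2) w'] N'.edge_path_groupoid_Comp[OF path[OF *(2)] path[OF w']]
      by (simp add: *(1,3) xy cls)
  qed (simp_all add: cls path N'.edge_class_in_Arr)
qed

section \<open>The universal property of the edge-path groupoid\<close>

text \<open>
  The 1-simplices generate the groupoid: every edge path is a composite of classes of one-step
  paths, and a backward step is the inverse of a forward one.
\<close>

lemma (in edge_complex) functor_eqI:
  assumes T: "groupoid T"
    and F: "gpd_functor (edge_path_groupoid N) T F" and F': "gpd_functor (edge_path_groupoid N) T F'"
    and obj: "\<And>x. [x] \<in> N 0 \<Longrightarrow> on_obj F x = on_obj F' x"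
    and arr: "\<And>x y. [x, y] \<in> N 1 \<Longrightarrow>
      on_arr F (edge_class N x y [Fwd x y]) = on_arr F' (edge_class N x y [Fwd x y])"
  shows "gpd_fun_eq (edge_path_groupoid N) F F'"
proof -
  let ?P = "edge_path_groupoid N"
  interpret P: groupoid ?P by (rule groupoid_edge_path_groupoid)
  have step: "on_arr F (edge_class N x y [s]) = on_arr F' (edge_class N x y [s])"
    if s: "edge_path N x [s] y" for x y s
  proof (cases s)
    case (Fwd a b)
    then show ?thesis using s arr by auto
  next
    case (Bwd a b)
    then have ab: "[a, b] \<in> N 1" "x = b" "y = a" using s by auto
    then have p: "edge_path N a [Fwd a b] b" using face0 by auto
    have "edge_class N b a [Bwd a b] = gpd_inv ?P (edge_class N a b [Fwd a b])"
      using edge_path_groupoid_inverse[OF p] edge_path_reverse[OF p] p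
      by (intro P.gpd_inv_unique) auto
    then show ?thesis
      using functor_inv[OF P.groupoid_axioms T F edge_class_in_Arr[OF p]]
        functor_inv[OF P.groupoid_axioms T F' edge_class_in_Arr[OF p]] arr ab Bwd by simp
  qed
  have "on_arr F (edge_class N x y w) = on_arr F' (edge_class N x y w)"
    if "edge_path N x w y" for x y w
    using that
  proof (induction w arbitrary: x)
    case Nil
    then have "y = x" "[x] \<in> N 0" by auto
    then show ?case using F F' obj unfolding gpd_functor_def by auto
  next
    case (Cons s w)
    then obtain z where z: "edge_path N x [s] z" "edge_path N z w y"
      using edge_path_append[of x "[s]" w y] by auto
    have "on_arr F'' (edge_class N x y (s # w)) =
        Comp T (on_arr F'' (edge_class N x z [s])) (on_arr F'' (edge_class N z y w))"
      if "gpd_functor ?P T F''" for F''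
      using gpd_functor_Comp[OF that edge_class_in_Arr[OF z(1)] edge_class_in_Arr[OF z(2)]]
        edge_path_groupoid_Comp[OF z] by simp
    then show ?case using F F' Cons.IH[OF z(2)] step[OF z(1)] by simp
  qed
  then show ?thesis
    using obj unfolding gpd_fun_eq_def by (auto elim!: edge_path_groupoid_arrowE)
qed

fun step_value :: "('o, 'm) gpd \<Rightarrow> ('a \<Rightarrow> 'a \<Rightarrow> 'm) \<Rightarrow> 'a step \<Rightarrow> 'm" where
  "step_value T s (Fwd a b) = s a b"
| "step_value T s (Bwd a b) = gpd_inv T (s a b)"

text \<open>
  The value of an edge path is taken as an operation on a terminal arrow \<open>t\<close>, with which the
  labels of the steps are composed. Concatenation of paths then becomes composition of
  operations, so a move inside a path can be treated without reassociating.
\<close>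

definition path_value :: "('o, 'm) gpd \<Rightarrow> ('a \<Rightarrow> 'a \<Rightarrow> 'm) \<Rightarrow> 'a step list \<Rightarrow> 'm \<Rightarrow> 'm" where
  "path_value T s w t = foldr (\<lambda>st. Comp T (step_value T s st)) w t"

lemma path_value_append [simp]: "path_value T s (u @ v) t = path_value T s u (path_value T s v t)"
  by (simp add: path_value_def)

lemma path_value_Nil [simp]: "path_value T s [] t = t"
  by (simp add: path_value_def)

lemma path_value_Cons [simp]:
  "path_value T s (st # w) t = Comp T (step_value T s st) (path_value T s w t)"
  by (simp add: path_value_def)

text \<open>
  A labelling of the 1-simplices that satisfies the relations imposed by the degenerate and the
  2-simplices. Such labellings are the functors out of the edge-path groupoid.
\<close>

locale simplex_labelling = edge_complex N + T: groupoid T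
  for N :: "nat \<Rightarrow> 'a list set" and T :: "('o, 'm) gpd" +
  fixes ob :: "'a \<Rightarrow> 'o" and s :: "'a \<Rightarrow> 'a \<Rightarrow> 'm"
  assumes ob: "[x] \<in> N 0 \<Longrightarrow> ob x \<in> Obj T"
    and s_in: "[x, y] \<in> N 1 \<Longrightarrow> s x y \<in> Arr T"
    and s_Dom: "[x, y] \<in> N 1 \<Longrightarrow> Dom T (s x y) = ob x"
    and s_Cod: "[x, y] \<in> N 1 \<Longrightarrow> Cod T (s x y) = ob y"
    and s_Ident: "[x, x] \<in> N 1 \<Longrightarrow> s x x = Ident T (ob x)"
    and s_Comp: "\<lbrakk>[x, y] \<in> N 1; [y, z] \<in> N 1; [x, z] \<in> N 1; [x, y, z] \<in> N 2\<rbrakk> \<Longrightarrow>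
      s x z = Comp T (s x y) (s y z)"
begin

lemma path_value_in:
  assumes "edge_path N x w y" "t \<in> Arr T" "Dom T t = ob y"
  shows "path_value T s w t \<in> Arr T \<and> Dom T (path_value T s w t) = ob x \<and>
    Cod T (path_value T s w t) = Cod T t"
  using assms(1)
proof (induction w arbitrary: x)
  case (Cons st w)
  then show ?case by (cases st) (auto simp: s_in s_Dom s_Cod T.gpd_inv T.gpd_simps)
qed (use assms(2,3) in auto)

lemma path_value_comp:
  assumes "edge_path N x w y" "t \<in> Arr T" "Dom T t = ob y"
  shows "path_value T s w t = Comp T (path_value T s w (Ident T (ob y))) t"
  using assms(1)
proof (induction w arbitrary: x)
  case Nil
  then show ?case using assms T.Ident_left[of t] by simp
next
  case (Cons st w)
  obtain z where z: "edge_path N x [st] z" "edge_path N z w y"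
    using Cons.prems edge_path_append[of x "[st]" w y] by auto
  have y: "ob y \<in> Obj T" using z(2) edge_path_ends ob by blast
  have 1: "path_value T s w (Ident T (ob y)) \<in> Arr T"
    "Dom T (path_value T s w (Ident T (ob y))) = ob z"
    "Cod T (path_value T s w (Ident T (ob y))) = ob y"
    using path_value_in[OF z(2), of "Ident T (ob y)"] y by (auto simp: T.gpd_simps)
  have "step_value T s st \<in> Arr T" "Cod T (step_value T s st) = ob z"
    using z(1) by (cases st; auto simp: s_in s_Dom s_Cod T.gpd_inv)+
  then show ?case using Cons.IH[OF z(2)] 1 assms(2,3) by (simp add: T.Comp_assoc)
qed

lemma path_value_move:
  assumes "edge_move N u v" "edge_path N x u y" "edge_path N x v y" "t \<in> Arr T" "Dom T t = ob y"
  shows "path_value T s u t = path_value T s v t"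
  using assms(1)
proof cases
  case (cancel_right a b p q)
  then have "edge_path N a q y" using assms(2) by (auto simp: edge_path_append)
  then show ?thesis using cancel_right path_value_in[OF _ assms(4,5)] T.comp_inv_cancel s_in s_Dom
    by simp
next
  case (cancel_left a b p q)
  then have "edge_path N b q y" using assms(2) by (auto simp: edge_path_append)
  then show ?thesis using cancel_left path_value_in[OF _ assms(4,5)] T.inv_comp_cancel s_in s_Cod
    by simp
next
  case (degenerate a p q)
  then have "edge_path N a q y" "[a, a] \<in> N 1" using assms(2) by (auto simp: edge_path_append)
  then show ?thesis
    using degenerate path_value_in[OF _ assms(4,5), of a q] s_Ident
      T.Ident_left[of "path_value T s q t"] by simp
next
  case (triangle a b c p q)
  have 1: "edge_path N c q y" "[a, c] \<in> N 1" "[a, b] \<in> N 1" "[b, c] \<in> N 1"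
    using assms(2,3) triangle by (auto simp: edge_path_append)
  then show ?thesis using triangle path_value_in[OF 1(1) assms(4,5)] s_Comp s_in s_Dom s_Cod
    by (simp add: T.Comp_assoc)
qed

lemma path_value_homotopic:
  assumes "edge_homotopic N x y u v" "t \<in> Arr T" "Dom T t = ob y"
  shows "path_value T s u t = path_value T s v t"
  using assms(1)
  by (induction rule: edge_homotopic_induct) (use path_value_move assms(2,3) in metis)+

text \<open>
  The functor evaluates any representative of a homotopy class. The four kinds of moves correspond
  to the two inverse laws, to \<open>s_Ident\<close> and to \<open>s_Comp\<close>, so the value does not depend on the
  representative.
\<close>

lemma functor_exists:
  obtains F where "gpd_functor (edge_path_groupoid N) T F" "on_obj F = ob"
    "\<And>x y. [x, y] \<in> N 1 \<Longrightarrow> on_arr F (edge_class N x y [Fwd x y]) = s x y"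
proof -
  define F where "F = \<lparr> on_obj = ob,
    on_arr = (\<lambda>(x :: 'a, c, y). path_value T s (SOME w. w \<in> c) (Ident T (ob y))) \<rparr>"
  have arr: "on_arr F (edge_class N x y w) = path_value T s w (Ident T (ob y))"
    if "edge_path N x w y" for x y w
  proof -
    have "edge_homotopic N x y w (SOME w'. edge_homotopic N x y w w')"
      by (rule someI[of _ w]) simp
    moreover have "ob y \<in> Obj T" using that edge_path_ends ob by blast
    ultimately show ?thesis
      using path_value_homotopic[of x y w _ "Ident T (ob y)"]
      by (simp add: F_def edge_class_def T.gpd_simps)
  qed
  have val: "path_value T s w (Ident T (ob y)) \<in> Arr T \<and>
      Dom T (path_value T s w (Ident T (ob y))) = ob x \<and>
      Cod T (path_value T s w (Ident T (ob y))) = ob y" if "edge_path N x w y" for x y w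
    using that path_value_in[OF that, of "Ident T (ob y)"] edge_path_ends[OF that] ob
    by (auto simp: T.gpd_simps)
  have "gpd_functor (edge_path_groupoid N) T F"
    unfolding gpd_functor_def
  proof (intro conjI ballI impI; (elim edge_path_groupoid_arrowE)?)
    fix x assume "x \<in> Obj (edge_path_groupoid N)"
    then show "on_obj F x \<in> Obj T"
      "on_arr F (Ident (edge_path_groupoid N) x) = Ident T (on_obj F x)"
      using ob arr[of x "[]" x] by (auto simp: F_def)
  next
    fix f g x w y x' w' y'
    assume *: "f = edge_class N x y w" "edge_path N x w y"
      "g = edge_class N x' y' w'" "edge_path N x' w' y'"
      "Cod (edge_path_groupoid N) f = Dom (edge_path_groupoid N) g"
    then have "edge_path N y w' y'" by simp
    moreover from this have "edge_path N x (w @ w') y'" using * edge_path_append by blast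
    ultimately show "on_arr F (Comp (edge_path_groupoid N) f g) = Comp T (on_arr F f) (on_arr F g)"
      using * path_value_comp[OF *(2)] val[of y w' y'] by (simp add: edge_path_groupoid_Comp arr)
  qed (use arr val in \<open>auto simp: F_def\<close>)
  moreover have "on_arr F (edge_class N x y [Fwd x y]) = s x y" if "[x, y] \<in> N 1" for x y
    using that arr[of x "[Fwd x y]" y] face0[OF that] T.Ident_right[OF s_in[OF that]] s_Cod[OF that]
    by simp
  ultimately show ?thesis by (intro that) (auto simp: F_def)
qed

end

section \<open>Directed walks and low-dimensional simplices\<close>

text \<open>
  \<open>dwalk Z x p y\<close> records a walk by its start \<open>x\<close> and the list \<open>p\<close> of the later vertices, so that
  \<open>length p\<close> is the length of the walk, walks are concatenated by \<open>@\<close>, and the \<open>i\<close>-th vertex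
  is \<open>(x # p) ! i\<close>.
\<close>

fun dwalk :: "'a pair_pre_digraph \<Rightarrow> 'a \<Rightarrow> 'a list \<Rightarrow> 'a \<Rightarrow> bool" where
  "dwalk Z x [] y \<longleftrightarrow> x = y \<and> x \<in> pverts Z"
| "dwalk Z x (a # p) y \<longleftrightarrow> (x, a) \<in> parcs Z \<and> dwalk Z a p y"

lemma dwalk_append: "dwalk Z x p y \<Longrightarrow> dwalk Z y q z \<Longrightarrow> dwalk Z x (p @ q) z"
  by (induction p arbitrary: x) auto

lemma dwalk_end: "dwalk Z x p y \<Longrightarrow> y \<in> pverts Z"
  by (induction p arbitrary: x) auto

lemma (in pair_wf_digraph) dwalk_start: "dwalk G x p y \<Longrightarrow> x \<in> pverts G"
  by (cases p) (auto dest: arc_fst_in_verts)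

lemma (in pair_wf_digraph) dwalk_arc: "(x, y) \<in> parcs G \<Longrightarrow> dwalk G x [y] y"
  by (auto dest: arc_snd_in_verts)

lemma dwalk_nth:
  "dwalk Z x p y \<Longrightarrow> (x # p) ! length p = y \<and> (\<forall>i < length p. ((x # p) ! i, (x # p) ! Suc i) \<in> parcs Z)"
  by (induction p arbitrary: x) (auto simp: less_Suc_eq_0_disj)

lemma dwalk_nthI:
  "y \<in> pverts Z \<Longrightarrow> (x # p) ! length p = y \<Longrightarrow>
    (\<And>i. i < length p \<Longrightarrow> ((x # p) ! i, (x # p) ! Suc i) \<in> parcs Z) \<Longrightarrow> dwalk Z x p y"
proof (induction p arbitrary: x)
  case (Cons a p)
  have "dwalk Z a p y"
  proof (rule Cons.IH)
    show "((a # p) ! i, (a # p) ! Suc i) \<in> parcs Z" if "i < length p" for i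
      using that Cons.prems(3)[of "Suc i"] by simp
  qed (use Cons.prems in auto)
  then show ?case using Cons.prems(3)[of 0] by simp
qed simp

text \<open>
  A map of graphs may contract edges, so the image of a directed path is a walk that may rest at a
  vertex. Dropping the rests only shortens it.
\<close>

lemma dwalk_stutter:
  assumes "g 0 \<in> pverts Z" "\<And>i. i < s \<Longrightarrow> (g i, g (Suc i)) \<in> parcs Z \<or> g i = g (Suc i)"
    and "pair_wf_digraph Z" "i \<le> s"
  shows "\<exists>p. dwalk Z (g 0) p (g i) \<and> length p \<le> i"
  using assms(4)
proof (induction i)
  case 0
  then show ?case using assms(1) by (intro exI[of _ "[]"]) simp
next
  case (Suc i)
  then obtain p where p: "dwalk Z (g 0) p (g i)" "length p \<le> i" by auto
  show ?case
  proof (cases "g i = g (Suc i)")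
    case True
    then show ?thesis using p by (intro exI[of _ p]) auto
  next
    case False
    then have "dwalk Z (g i) [g (Suc i)] (g (Suc i))"
      using assms(2)[of i] pair_wf_digraph.dwalk_arc[OF assms(3)] Suc by auto
    from dwalk_append[OF p(1) this] p(2) show ?thesis
      by (intro exI[of _ "p @ [g (Suc i)]"]) auto
  qed
qed

lemma (in pair_wf_digraph) vwalk_iff_dwalk:
  "vwalk (x # p) (with_proj G) \<and> last (x # p) = y \<longleftrightarrow> dwalk G x p y"
proof (induction p arbitrary: x)
  case Nil
  then show ?case by (auto simp: vwalk_def)
next
  case (Cons a p)
  have "arcs_ends (with_proj G) = parcs G"
    by (auto simp: arcs_ends_def arc_to_ends_def)
  then have "vwalk (x # a # p) (with_proj G) \<longleftrightarrow> (x, a) \<in> parcs G \<and> vwalk (a # p) (with_proj G)"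
    by (auto simp: vwalk_def dest: arc_fst_in_verts)
  then show ?case using Cons[of a] by auto
qed

lemma (in pair_wf_digraph) ddist_le_enat_iff:
  "ddist G x y \<le> enat n \<longleftrightarrow> (\<exists>p. dwalk G x p y \<and> length p \<le> n)"
proof -
  let ?S = "(\<lambda>p. enat (vwalk_length p)) ` {p. vwalk p (with_proj G) \<and> hd p = x \<and> last p = y}"
  have mem: "enat k \<in> ?S \<longleftrightarrow> (\<exists>p. dwalk G x p y \<and> length p = k)" for k
  proof
    assume "enat k \<in> ?S"
    then obtain p where p: "vwalk p (with_proj G)" "hd p = x" "last p = y" "length p - 1 = k"
      by auto
    then have "p = x # tl p" by (cases p) (auto simp: vwalk_def)
    with p show "\<exists>p. dwalk G x p y \<and> length p = k"
      using vwalk_iff_dwalk[of x "tl p" y] by (metis length_tl)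
  next
    assume "\<exists>p. dwalk G x p y \<and> length p = k"
    then obtain p where "dwalk G x p y" "length p = k" by blast
    then show "enat k \<in> ?S"
      using vwalk_iff_dwalk[of x p y] by (intro image_eqI[of _ _ "x # p"]) auto
  qed
  show ?thesis
  proof
    assume le: "ddist G x y \<le> enat n"
    have "?S \<noteq> {}"
    proof
      assume "?S = {}"
      then have "ddist G x y = \<infinity>" unfolding ddist_def by (metis Inf_empty top_enat_def)
      with le show False by simp
    qed
    then have "Inf ?S \<in> ?S" unfolding Inf_enat_def by (auto intro: LeastI)
    then have "ddist G x y \<in> ?S" by (simp add: ddist_def)
    moreover obtain k where "ddist G x y = enat k" "k \<le> n"
      using le by (cases "ddist G x y") auto
    ultimately show "\<exists>p. dwalk G x p y \<and> length p \<le> n"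
      using mem[of k] by auto
  next
    assume "\<exists>p. dwalk G x p y \<and> length p \<le> n"
    then obtain p where p: "dwalk G x p y" "length p \<le> n" by blast
    then have "enat (length p) \<in> ?S" using mem by blast
    then have "ddist G x y \<le> enat (length p)" unfolding ddist_def by (rule Inf_lower)
    with p(2) show "ddist G x y \<le> enat n" by (meson enat_ord_simps(1) order_trans)
  qed
qed

text \<open>
  The conditions for finite and for infinite \<open>r\<close> both say that some natural number not above \<open>r\<close>
  bounds the length. In this form, and in the descriptions of the nerve by walks that follow from
  it, both cases of the theorem are treated at once.
\<close>

lemma nerve_bound_iff:
  "(if r = \<infinity> then t < \<infinity> else t \<le> r) \<longleftrightarrow> (\<exists>n. t \<le> enat n \<and> enat n \<le> r)" for t r :: enat
  by (cases t; cases r) auto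

lemma nerve_0_iff: "[x] \<in> nerve r Z 0 \<longleftrightarrow> x \<in> pverts Z"
  by (auto simp: nerve_def tuple_length_def)

context pair_wf_digraph
begin

lemma nerve_1_iff: "[x, y] \<in> nerve r G 1 \<longleftrightarrow> (\<exists>p. dwalk G x p y \<and> enat (length p) \<le> r)"
proof -
  have "tuple_length G [x, y] = ddist G x y" by (simp add: tuple_length_def)
  moreover have "(\<exists>n. (\<exists>p. dwalk G x p y \<and> length p \<le> n) \<and> enat n \<le> r) \<longleftrightarrow>
      (\<exists>p. dwalk G x p y \<and> enat (length p) \<le> r)"
    by (meson enat_ord_simps(1) order_refl order_trans)
  ultimately show ?thesis
    using dwalk_start dwalk_end[of G] by (auto simp: nerve_def nerve_bound_iff ddist_le_enat_iff)
qed

lemma nerve_2_iff: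
  "[x, y, z] \<in> nerve r G 2 \<longleftrightarrow>
    (\<exists>p q. dwalk G x p y \<and> dwalk G y q z \<and> enat (length p + length q) \<le> r)"
proof -
  have len: "tuple_length G [x, y, z] = ddist G x y + ddist G y z"
    by (simp add: tuple_length_def numeral_2_eq_2)
  have split: "s + t \<le> enat n \<longleftrightarrow> (\<exists>k l. s \<le> enat k \<and> t \<le> enat l \<and> k + l \<le> n)" for s t :: enat and n
  proof
    assume "s + t \<le> enat n"
    then obtain k l where "s = enat k" "t = enat l" "k + l \<le> n" by (cases s; cases t) auto
    then show "\<exists>k l. s \<le> enat k \<and> t \<le> enat l \<and> k + l \<le> n" by auto
  next
    assume "\<exists>k l. s \<le> enat k \<and> t \<le> enat l \<and> k + l \<le> n"
    then obtain k l where "s \<le> enat k" "t \<le> enat l" "k + l \<le> n" by blast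
    then have "s + t \<le> enat (k + l)" using add_mono[of s "enat k" t "enat l"] by simp
    with \<open>k + l \<le> n\<close> show "s + t \<le> enat n" by (meson enat_ord_simps(1) order_trans)
  qed
  have "(\<exists>n. ddist G x y + ddist G y z \<le> enat n \<and> enat n \<le> r) \<longleftrightarrow>
      (\<exists>p q. dwalk G x p y \<and> dwalk G y q z \<and> enat (length p + length q) \<le> r)"
    unfolding split ddist_le_enat_iff
    by (meson add_mono enat_ord_simps(1) order_refl order_trans)
  then show ?thesis
    using dwalk_start dwalk_end[of G] by (auto simp: nerve_def len nerve_bound_iff)
qed

end

lemma edge_complex_nerve: "edge_complex (nerve r Z)"
  by unfold_locales (auto simp: nerve_def tuple_length_def)

lemma nerve_mono:
  assumes "pverts X \<subseteq> pverts Z" "parcs X \<subseteq> parcs Z"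
  shows "nerve r X n \<subseteq> nerve r Z n"
proof -
  have "vwalk p (with_proj Z)" if "vwalk p (with_proj X)" for p
    using that assms by (auto simp: vwalk_def arcs_ends_def arc_to_ends_def)
  then have "ddist Z x y \<le> ddist X x y" for x y
    unfolding ddist_def by (intro INF_superset_mono) auto
  then have "tuple_length Z xs \<le> tuple_length X xs" for xs
    unfolding tuple_length_def by (intro sum_mono)
  then show ?thesis
    using assms(1) unfolding nerve_def nerve_bound_iff by (blast intro: order_trans)
qed

section \<open>Values of walks\<close>

context edge_complex
begin

lemma edge_class_Fwd_degenerate:
  assumes "[x, x] \<in> N 1"
  shows "edge_class N x x [Fwd x x] = edge_class N x x []"
  unfolding edge_class_eq_iff
  using assms face0[OF assms] edge_move.degenerate[of x N "[]" "[]"]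
  by (auto intro!: edge_move_homotopic)

lemma edge_class_Fwd_comp:
  assumes "[x, y, z] \<in> N 2" "[x, y] \<in> N 1" "[y, z] \<in> N 1" "[x, z] \<in> N 1"
  shows "edge_class N x z [Fwd x z] =
    Comp (edge_path_groupoid N) (edge_class N x y [Fwd x y]) (edge_class N y z [Fwd y z])"
proof -
  have p: "edge_path N x [Fwd x y] y" "edge_path N y [Fwd y z] z" "edge_path N x [Fwd x z] z"
    using assms face0 by auto
  then have "edge_path N x [Fwd x y, Fwd y z] z" using edge_path_append[of x "[Fwd x y]"] by auto
  then have "edge_homotopic N x z [Fwd x z] [Fwd x y, Fwd y z]"
    using edge_move.triangle[of x y z N "[]" "[]"] assms(1) p by (intro edge_move_homotopic) auto
  then show ?thesis using edge_path_groupoid_Comp[OF p(1,2)] by (simp add: edge_class_eq_iff)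
qed

end

fun walk_value :: "('o, 'm) gpd \<Rightarrow> ('a \<Rightarrow> 'o) \<Rightarrow> ('a \<Rightarrow> 'a \<Rightarrow> 'm) \<Rightarrow> 'a \<Rightarrow> 'a list \<Rightarrow> 'm" where
  "walk_value T ob e x [] = Ident T (ob x)"
| "walk_value T ob e x (a # p) = Comp T (e x a) (walk_value T ob e a p)"

lemma walk_value_cong:
  assumes "dwalk Z x p y" "\<And>a. a \<in> pverts Z \<Longrightarrow> ob a = ob' a"
    and "\<And>a b. (a, b) \<in> parcs Z \<Longrightarrow> e a b = e' a b"
  shows "walk_value T ob e x p = walk_value T ob' e' x p"
  using assms(1) by (induction p arbitrary: x) (auto simp: assms(2,3))

abbreviation simplex_class :: "enat \<Rightarrow> 'a pair_pre_digraph \<Rightarrow> 'a \<Rightarrow> 'a \<Rightarrow> 'a edge_arrow" where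
  "simplex_class r Z x y \<equiv> edge_class (nerve r Z) x y [Fwd x y]"

context pair_wf_digraph
begin

lemma simplex_class_in:
  assumes "dwalk G x p y" "enat (length p) \<le> r"
  shows "simplex_class r G x y \<in> Arr (edge_path_groupoid (nerve r G))"
proof -
  interpret N: edge_complex "nerve r G" by (rule edge_complex_nerve)
  have "[x, y] \<in> nerve r G 1" using assms nerve_1_iff by blast
  then show ?thesis using N.face0 by (intro N.edge_class_in_Arr) auto
qed

lemma simplex_class_comp:
  assumes "dwalk G x p y" "dwalk G y q z" "enat (length p + length q) \<le> r"
  shows "simplex_class r G x z =
    Comp (edge_path_groupoid (nerve r G)) (simplex_class r G x y) (simplex_class r G y z)"
proof -
  interpret N: edge_complex "nerve r G" by (rule edge_complex_nerve)
  have le: "enat (length p) \<le> r" "enat (length q) \<le> r"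
    using assms(3) by (meson enat_ord_simps(1) le_add1 le_add2 order_trans)+
  have "[x, z] \<in> nerve r G 1"
    using assms dwalk_append[OF assms(1,2)] nerve_1_iff[of x z r] by (metis length_append)
  moreover have "[x, y] \<in> nerve r G 1" "[y, z] \<in> nerve r G 1" "[x, y, z] \<in> nerve r G 2"
    using assms le nerve_1_iff nerve_2_iff by blast+
  ultimately show ?thesis by (intro N.edge_class_Fwd_comp)
qed

lemma functor_simplex_comp:
  assumes "gpd_functor (fund_groupoid r G) T F"
    and "dwalk G x p y" "dwalk G y q z" "enat (length p + length q) \<le> r"
  shows "on_arr F (simplex_class r G x z) =
    Comp T (on_arr F (simplex_class r G x y)) (on_arr F (simplex_class r G y z))"
proof -
  have le: "enat (length p) \<le> r" "enat (length q) \<le> r"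
    using assms(4) by (meson enat_ord_simps(1) le_add1 le_add2 order_trans)+
  interpret N: edge_complex "nerve r G" by (rule edge_complex_nerve)
  show ?thesis
    using gpd_functor_Comp[OF assms(1)[unfolded fund_groupoid_def]
        simplex_class_in[OF assms(2) le(1)] simplex_class_in[OF assms(3) le(2)]]
      simplex_class_comp[OF assms(2-4)] by simp
qed

lemma functor_simplex_ends:
  assumes "gpd_functor (fund_groupoid r G) T F" "dwalk G x p y" "enat (length p) \<le> r"
  shows "on_arr F (simplex_class r G x y) \<in> Arr T"
    "Dom T (on_arr F (simplex_class r G x y)) = on_obj F x"
    "Cod T (on_arr F (simplex_class r G x y)) = on_obj F y"
proof -
  interpret N: edge_complex "nerve r G" by (rule edge_complex_nerve)
  note F = assms(1)[unfolded fund_groupoid_def] simplex_class_in[OF assms(2,3)]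
  show "on_arr F (simplex_class r G x y) \<in> Arr T"
    "Dom T (on_arr F (simplex_class r G x y)) = on_obj F x"
    "Cod T (on_arr F (simplex_class r G x y)) = on_obj F y"
    using gpd_functor_arr[OF F] gpd_functor_Dom[OF F] gpd_functor_Cod[OF F] by simp_all
qed

text \<open>
  Splitting off the first arc of a walk of length at most \<open>r\<close> gives a 2-simplex, whose relation
  factors the value of the functor. Hence functors are determined by their values on arcs, and two
  parallel walks of length at most \<open>r\<close> have the same value.
\<close>

lemma functor_simplex_eq_walk_value:
  assumes F: "gpd_functor (fund_groupoid r G) T F"
    and "dwalk G x p y" "enat (length p) \<le> r"
  shows "on_arr F (simplex_class r G x y) =
    walk_value T (on_obj F) (\<lambda>a b. on_arr F (simplex_class r G a b)) x p"
  using assms(2,3)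
proof (induction p arbitrary: x)
  case Nil
  interpret N: edge_complex "nerve r G" by (rule edge_complex_nerve)
  have x: "x = y" "x \<in> pverts G" using Nil by auto
  then have "[x, x] \<in> nerve r G 1" using Nil nerve_1_iff by blast
  then have "simplex_class r G x x = Ident (edge_path_groupoid (nerve r G)) x"
    by (simp add: N.edge_class_Fwd_degenerate)
  then show ?case
    using gpd_functor_Ident[OF F[unfolded fund_groupoid_def], of x] x by (simp add: nerve_0_iff)
next
  case (Cons a p)
  then have xa: "dwalk G x [a] a" and ay: "dwalk G a p y" by (auto intro: dwalk_start)
  have "enat (length p) \<le> r" using Cons.prems(2) by (auto intro: order_trans[rotated])
  then show ?case
    using functor_simplex_comp[OF F xa ay] Cons.IH[OF ay] Cons.prems(2) by simp
qed

end

section \<open>Potentials and subdivisions\<close>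

text \<open>
  A labelling of the arcs of \<open>Z\<close> by arrows of \<open>T\<close>, with no relation imposed: a functor from the
  free groupoid on \<open>Z\<close>.
\<close>

locale arc_labelling = groupoid T for T :: "('o, 'm) gpd" +
  fixes Z :: "'a pair_pre_digraph" and ob :: "'a \<Rightarrow> 'o" and e :: "'a \<Rightarrow> 'a \<Rightarrow> 'm"
  assumes wf: "pair_wf_digraph Z"
    and ob: "a \<in> pverts Z \<Longrightarrow> ob a \<in> Obj T"
    and e_in: "(a, b) \<in> parcs Z \<Longrightarrow> e a b \<in> Arr T"
    and e_Dom: "(a, b) \<in> parcs Z \<Longrightarrow> Dom T (e a b) = ob a"
    and e_Cod: "(a, b) \<in> parcs Z \<Longrightarrow> Cod T (e a b) = ob b"
begin

lemma walk_value_in: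
  assumes "dwalk Z x p y"
  shows "walk_value T ob e x p \<in> Arr T \<and> Dom T (walk_value T ob e x p) = ob x \<and>
    Cod T (walk_value T ob e x p) = ob y"
  using assms by (induction p arbitrary: x) (auto simp: gpd_simps ob e_in e_Dom e_Cod)

lemma walk_value_append:
  assumes "dwalk Z x p y" "dwalk Z y q z"
  shows "walk_value T ob e x (p @ q) = Comp T (walk_value T ob e x p) (walk_value T ob e y q)"
  using assms(1)
proof (induction p arbitrary: x)
  case Nil
  then show ?case using walk_value_in[OF assms(2)] Ident_left[of "walk_value T ob e y q"] by simp
next
  case (Cons a p)
  then show ?case
    using walk_value_in[of a p y] walk_value_in[OF assms(2)]
    by (simp add: Comp_assoc e_in e_Cod)
qed

text \<open>
  A potential writes the label of each arc \<open>(a, b)\<close> of \<open>M\<close> as the inverse of \<open>p a\<close> followed by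
  \<open>p b\<close>. On a connected \<open>M\<close> there is one iff all closed edge paths in \<open>M\<close> have trivial value.
  Whether a graph is balanced depends on the subgraph alone and not on a loop that represents
  it, which is what makes it usable for subdivisions.
\<close>

definition potential :: "'a pair_pre_digraph \<Rightarrow> 'o \<Rightarrow> ('a \<Rightarrow> 'm) \<Rightarrow> bool" where
  "potential M t p \<longleftrightarrow>
     (\<forall>a \<in> pverts M. p a \<in> Arr T \<and> Dom T (p a) = t \<and> Cod T (p a) = ob a) \<and>
     (\<forall>(a, b) \<in> parcs M. (a, b) \<in> parcs Z \<and> a \<in> pverts M \<and> b \<in> pverts M \<and>
        Comp T (p a) (e a b) = p b)"

definition balanced :: "'a pair_pre_digraph \<Rightarrow> bool" where
  "balanced M \<longleftrightarrow> (\<exists>t p. potential M t p)"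

text \<open>
  If \<open>\<phi>\<close> is a potential, then the value of a walk from \<open>x\<close> to \<open>y\<close> is the inverse of
  \<open>\<phi> x\<close> followed by \<open>\<phi> y\<close>.
\<close>

lemma balanced_parallel_walks:
  assumes "balanced M" "dwalk M x p y" "dwalk M x q y" "dwalk Z x p y" "dwalk Z x q y"
  shows "walk_value T ob e x p = walk_value T ob e x q"
proof -
  obtain t \<phi> where \<phi>: "potential M t \<phi>" using assms(1) by (auto simp: balanced_def)
  have val: "Comp T (\<phi> x) (walk_value T ob e x p) = \<phi> y"
    if "dwalk M x p y" "dwalk Z x p y" for x p
    using that
  proof (induction p arbitrary: x)
    case Nil
    then have "\<phi> x \<in> Arr T" "Cod T (\<phi> x) = ob x" "x = y" using \<phi> by (auto simp: potential_def)
    then show ?case using Ident_right[of "\<phi> x"] by simp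
  next
    case (Cons a p)
    then have *: "\<phi> x \<in> Arr T" "Cod T (\<phi> x) = ob x" "Comp T (\<phi> x) (e x a) = \<phi> a" "(x, a) \<in> parcs Z"
      using \<phi> by (auto simp: potential_def)
    then show ?case
      using Cons walk_value_in[of a p y] Comp_assoc[of "\<phi> x" "e x a" "walk_value T ob e a p"]
      by (simp add: e_in e_Dom e_Cod)
  qed
  have "x \<in> pverts M" using assms(2) \<phi> by (cases p) (auto simp: potential_def)
  then have "\<phi> x \<in> Arr T" "Cod T (\<phi> x) = ob x" using \<phi> by (auto simp: potential_def)
  then show ?thesis
    using val[OF assms(2,4)] val[OF assms(3,5)] walk_value_in[OF assms(4)] walk_value_in[OF assms(5)]
    by (simp add: comp_left_cancel[of "\<phi> x"])
qed

lemma potential_subgraph: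
  assumes "potential M t \<phi>" "pverts L \<subseteq> pverts M" "parcs L \<subseteq> parcs M"
    and ends: "\<And>a b. (a, b) \<in> parcs L \<Longrightarrow> a \<in> pverts L \<and> b \<in> pverts L"
  shows "potential L t \<phi>"
proof -
  have "\<phi> a \<in> Arr T \<and> Dom T (\<phi> a) = t \<and> Cod T (\<phi> a) = ob a" if "a \<in> pverts L" for a
    using that assms(1,2) unfolding potential_def by blast
  moreover have "(a, b) \<in> parcs Z \<and> Comp T (\<phi> a) (e a b) = \<phi> b" if "(a, b) \<in> parcs L" for a b
    using that assms(1,3) unfolding potential_def by blast
  ultimately show ?thesis using ends unfolding potential_def by auto
qed

lemma potential_translate:
  assumes "potential M t \<phi>" "g \<in> Arr T" "Cod T g = t"
  shows "potential M (Dom T g) (\<lambda>a. Comp T g (\<phi> a))"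
proof -
  have "Comp T (Comp T g (\<phi> a)) (e a b) = Comp T g (\<phi> b)" if "(a, b) \<in> parcs M" for a b
    using that assms Comp_assoc[of g "\<phi> a" "e a b"] by (force simp: potential_def e_in e_Dom)
  then show ?thesis using assms by (auto simp: potential_def gpd_simps)
qed

text \<open>
  A potential is determined along a connected graph by one value: an arc between two vertices
  carries agreement from either endpoint to the other, by cancellation. The image of a segment of a
  path is connected.
\<close>

lemma potentials_agree_on_path:
  assumes "potential M t \<phi>" "potential M t \<psi>" "I \<in> line_graphs n" "l \<le> n" "k \<le> l"
    and M: "M = graph_image (induced_segment I k l) f" and "\<phi> (f k) = \<psi> (f k)"
    and "a \<in> pverts M"
  shows "\<phi> a = \<psi> a"
proof -
  have I: "pverts I = {0..n}" "\<And>i. i < n \<Longrightarrow> (i, Suc i) \<in> parcs I \<or> (Suc i, i) \<in> parcs I"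
    using assms(3) by (auto simp: line_graphs_def)
  have arcs: "(a, b) \<in> parcs I \<Longrightarrow> a \<in> {k..l} \<Longrightarrow> b \<in> {k..l} \<Longrightarrow> f a \<noteq> f b \<Longrightarrow> (f a, f b) \<in> parcs M"
    for a b by (auto simp: M graph_image_def induced_segment_def)
  have agree: "\<phi> a = \<psi> a \<longleftrightarrow> \<phi> b = \<psi> b" if "(a, b) \<in> parcs M" for a b
  proof -
    have "Comp T (\<phi> a) (e a b) = \<phi> b" "Comp T (\<psi> a) (e a b) = \<psi> b" "(a, b) \<in> parcs Z"
      "\<phi> a \<in> Arr T" "\<psi> a \<in> Arr T" "Cod T (\<phi> a) = ob a" "Cod T (\<psi> a) = ob a"
      using that assms(1,2) by (auto simp: potential_def)
    then show ?thesis using comp_right_cancel[of "\<phi> a" "\<psi> a" "e a b"] by (auto simp: e_in e_Dom)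
  qed
  have "\<phi> (f i) = \<psi> (f i)" if "k \<le> i" "i \<le> l" for i
    using that
  proof (induction i rule: dec_induct)
    case base
    then show ?case using assms(7) by simp
  next
    case (step i)
    show ?case
    proof (cases "f i = f (Suc i)")
      case False
      then have "(f i, f (Suc i)) \<in> parcs M \<or> (f (Suc i), f i) \<in> parcs M"
        using arcs[of i "Suc i"] arcs[of "Suc i" i] I(2)[of i] step assms(4) by auto
      then show ?thesis using step agree by auto
    qed (use step in simp)
  qed
  moreover have "pverts M \<subseteq> f ` {k..l}" by (auto simp: M graph_image_def induced_segment_def)
  ultimately show ?thesis using assms(8) by auto
qed

text \<open>
  The van Kampen step. Translating the second potential makes it agree with the first at one vertex
  of the intersection. Since the intersection is connected, they agree on all of it and glue.
\<close>

lemma balanced_union: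
  assumes "balanced M\<^sub>1" "balanced M\<^sub>2" "I \<in> line_graphs n"
    and "represented_by_subpath (graph_int M\<^sub>1 M\<^sub>2) n I f"
  shows "balanced (graph_un M\<^sub>1 M\<^sub>2)"
proof -
  let ?M = "graph_int M\<^sub>1 M\<^sub>2"
  obtain t \<phi> s \<psi> where \<phi>: "potential M\<^sub>1 t \<phi>" and \<psi>: "potential M\<^sub>2 s \<psi>"
    using assms(1,2) by (auto simp: balanced_def)
  obtain k l where kl: "k \<le> l" "l \<le> n" "?M = graph_image (induced_segment I k l) f"
    using assms(4) by (auto simp: represented_by_subpath_def)
  have "f k \<in> pverts ?M"
    using kl assms(3) by (auto simp: graph_image_def induced_segment_def line_graphs_def)
  then have c: "f k \<in> pverts M\<^sub>1" "f k \<in> pverts M\<^sub>2" by (auto simp: graph_int_def)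
  \<comment> \<open>The arrow that moves the second potential onto the first at the vertex \<open>f k\<close>.\<close>
  define g where "g = Comp T (\<phi> (f k)) (gpd_inv T (\<psi> (f k)))"
  have at_c: "\<phi> (f k) \<in> Arr T" "Cod T (\<phi> (f k)) = ob (f k)" "Dom T (\<phi> (f k)) = t"
    "\<psi> (f k) \<in> Arr T" "Cod T (\<psi> (f k)) = ob (f k)" "Dom T (\<psi> (f k)) = s"
    using c \<phi> \<psi> by (auto simp: potential_def)
  then have g: "g \<in> Arr T" "Dom T g = t" "Cod T g = s"
    by (auto simp: g_def gpd_simps gpd_inv)
  define \<psi>' where "\<psi>' = (\<lambda>a. Comp T g (\<psi> a))"
  have \<psi>': "potential M\<^sub>2 t \<psi>'" using potential_translate[OF \<psi> g(1,3)] g(2) by (simp add: \<psi>'_def)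
  have base: "\<phi> (f k) = \<psi>' (f k)"
    using at_c Ident_right[of "\<phi> (f k)"] by (simp add: \<psi>'_def g_def Comp_assoc gpd_inv)
  have agree: "\<phi> a = \<psi>' a" if "a \<in> pverts M\<^sub>1" "a \<in> pverts M\<^sub>2" for a
  proof (rule potentials_agree_on_path[where M = ?M, OF _ _ assms(3) kl(2,1,3)])
    show "\<phi> (f k) = \<psi>' (f k)" by (rule base)
    have ends: "a \<in> pverts ?M \<and> b \<in> pverts ?M" if "(a, b) \<in> parcs ?M" for a b
      using that \<phi> \<psi>' by (auto simp: potential_def graph_int_def)
    show "potential ?M t \<phi>"
      by (rule potential_subgraph[OF \<phi> _ _ ends]) (auto simp: graph_int_def)
    show "potential ?M t \<psi>'"
      by (rule potential_subgraph[OF \<psi>' _ _ ends]) (auto simp: graph_int_def)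
    show "a \<in> pverts ?M" using that by (simp add: graph_int_def)
  qed
  define \<chi> where "\<chi> = (\<lambda>a. if a \<in> pverts M\<^sub>1 then \<phi> a else \<psi>' a)"
  have \<chi>: "\<chi> a = \<phi> a" if "a \<in> pverts M\<^sub>1" for a using that by (simp add: \<chi>_def)
  have \<chi>': "\<chi> a = \<psi>' a" if "a \<in> pverts M\<^sub>2" for a using that agree by (simp add: \<chi>_def)
  have "potential (graph_un M\<^sub>1 M\<^sub>2) t \<chi>"
    using \<phi> \<psi>' unfolding potential_def graph_un_def by (auto simp: \<chi> \<chi>')
  then show ?thesis by (auto simp: balanced_def)
qed

lemma balanced_subdivides_into_two:
  assumes "subdivides_into_two W L L\<^sub>1 L\<^sub>2" "balanced L\<^sub>1" "balanced L\<^sub>2"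
  shows "balanced L"
proof -
  obtain n I f where "reduced_loop W n I f" "represented_by_subpath (graph_int L\<^sub>1 L\<^sub>2) n I f"
    using assms(1) by (auto simp: subdivides_into_two_def)
  then have "balanced (graph_un L\<^sub>1 L\<^sub>2)"
    using balanced_union assms(2,3) by (auto simp: reduced_loop_def reduced_path_def)
  then obtain t \<phi> where \<phi>: "potential (graph_un L\<^sub>1 L\<^sub>2) t \<phi>" by (auto simp: balanced_def)
  have L: "L = graph_compl (graph_un L\<^sub>1 L\<^sub>2) (graph_int L\<^sub>1 L\<^sub>2)"
    using assms(1) by (simp add: subdivides_into_two_def)
  have "potential L t \<phi>"
  proof (rule potential_subgraph[OF \<phi>])
    show "parcs L \<subseteq> parcs (graph_un L\<^sub>1 L\<^sub>2)" by (auto simp: L graph_compl_def)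
    show "pverts L \<subseteq> pverts (graph_un L\<^sub>1 L\<^sub>2)"
      using \<phi> by (auto simp: L graph_compl_def potential_def)
    show "a \<in> pverts L \<and> b \<in> pverts L" if "(a, b) \<in> parcs L" for a b
      using that by (force simp: L graph_compl_def)
  qed
  then show ?thesis by (auto simp: balanced_def)
qed

lemma balanced_subdivision:
  assumes "subdivision W L Ls" "\<forall>M \<in> set Ls. balanced M"
  shows "balanced L"
  using assms
proof (induction rule: subdivision.induct)
  case (step Ms M Ms' M\<^sub>1 M\<^sub>2)
  then have "balanced M" using balanced_subdivides_into_two by auto
  with step show ?case by auto
qed simp

text \<open>
  Let \<open>x\<close> be the image of the first vertex of \<open>\<Gamma>\<^sub>s\<close>. Every vertex \<open>a\<close> of the image is at distance
  at most \<open>r\<close> from \<open>x\<close>, so the 1-simplex \<open>(x, a)\<close> exists and its value under the functor is a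
  potential at \<open>a\<close>: an arc \<open>(a, b)\<close> of the image leaves a vertex that is reached in fewer than \<open>s\<close>
  steps, so \<open>(x, a, b)\<close> is a 2-simplex. This argument covers images in which vertices of \<open>\<Gamma>\<^sub>s\<close>
  have been identified.
\<close>

lemma balanced_degenerate_Gamma:
  assumes A: "pair_wf_digraph A" "parcs A \<subseteq> parcs Z"
    and F: "gpd_functor (fund_groupoid r A) T F"
    and F_ob: "\<And>a. a \<in> pverts A \<Longrightarrow> on_obj F a = ob a"
    and F_e: "\<And>a b. (a, b) \<in> parcs A \<Longrightarrow> on_arr F (simplex_class r A a b) = e a b"
    and "enat s \<le> r" "degenerate_Gamma s A M"
  shows "balanced M"
proof -
  interpret A: pair_wf_digraph A by fact
  obtain f where f: "graph_map (Gamma_graph s) A f" and M: "M = graph_image (Gamma_graph s) f"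
    using assms(7) by (auto simp: degenerate_Gamma_def)
  define x where "x = f (gamma_u 0)"
  have x: "x \<in> pverts A" using f by (auto simp: x_def graph_map_def Gamma_graph_def)
  have u_arc: "(f (gamma_u i), f (gamma_u (Suc i))) \<in> parcs A \<or> f (gamma_u i) = f (gamma_u (Suc i))"
    and v_arc: "(f (gamma_v s i), f (gamma_v s (Suc i))) \<in> parcs A \<or>
      f (gamma_v s i) = f (gamma_v s (Suc i))" if "i < s" for i
    using f that by (fastforce simp: graph_map_def Gamma_graph_def)+
  have v0: "gamma_v s 0 = gamma_u 0" by (simp add: gamma_u_def gamma_v_def)
  have u_walk: "\<exists>p. dwalk A x p (f (gamma_u i)) \<and> length p \<le> i" if "i \<le> s" for i
    using dwalk_stutter[of "\<lambda>i. f (gamma_u i)" A s i] u_arc x that A(1) by (simp add: x_def)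
  have v_walk: "\<exists>p. dwalk A x p (f (gamma_v s i)) \<and> length p \<le> i" if "i \<le> s" for i
    using dwalk_stutter[of "\<lambda>i. f (gamma_v s i)" A s i] v_arc x that A(1) by (simp add: x_def v0)
  have verts: "\<exists>p. dwalk A x p a \<and> length p \<le> s" if "a \<in> pverts M" for a
    using that u_walk v_walk unfolding M graph_image_def Gamma_graph_def
    by (auto; meson le_trans)
  have arcs: "(a, b) \<in> parcs A \<and> a \<in> pverts M \<and> b \<in> pverts M \<and>
      (\<exists>p. dwalk A x p a \<and> length p < s)" if ab: "(a, b) \<in> parcs M" for a b
  proof -
    obtain i where i: "i < s" "a \<noteq> b"
      "a = f (gamma_u i) \<and> b = f (gamma_u (Suc i)) \<or> a = f (gamma_v s i) \<and> b = f (gamma_v s (Suc i))"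
      using ab by (auto simp: M graph_image_def Gamma_graph_def)
    have "(a, b) \<in> parcs A" using i u_arc[of i] v_arc[of i] by auto
    moreover have "a \<in> pverts M" "b \<in> pverts M"
      using i by (auto simp: M graph_image_def Gamma_graph_def)
    moreover have "\<exists>p. dwalk A x p a \<and> length p < s"
      using i u_walk[of i] v_walk[of i] by (metis less_imp_le_nat order_le_less_trans)
    ultimately show ?thesis by blast
  qed
  let ?\<phi> = "\<lambda>a. on_arr F (simplex_class r A x a)"
  have "potential M (on_obj F x) ?\<phi>"
    unfolding potential_def
  proof (intro conjI ballI; clarify?)
    fix a assume "a \<in> pverts M"
    then obtain p where p: "dwalk A x p a" "length p \<le> s" using verts by blast
    then have "enat (length p) \<le> r" using assms(6) by (meson enat_ord_simps(1) order_trans)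
    from A.functor_simplex_ends[OF F p(1) this] F_ob[OF dwalk_end[OF p(1)]]
    show "?\<phi> a \<in> Arr T" "Dom T (?\<phi> a) = on_obj F x" "Cod T (?\<phi> a) = ob a" by simp_all
  next
    fix a b assume "(a, b) \<in> parcs M"
    then obtain p where p: "dwalk A x p a" "length p < s" and ab: "(a, b) \<in> parcs A"
      "a \<in> pverts M" "b \<in> pverts M"
      using arcs by blast
    have "enat (length p + length [b]) \<le> r"
      using p(2) assms(6) by (simp add: Suc_le_eq order_trans[OF _ assms(6)])
    from A.functor_simplex_comp[OF F p(1) A.dwalk_arc[OF ab(1)] this] F_e[OF ab(1)] ab A(2)
    show "(a, b) \<in> parcs Z \<and> a \<in> pverts M \<and> b \<in> pverts M \<and> Comp T (?\<phi> a) (e a b) = ?\<phi> b" by auto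
  qed
  then show ?thesis by (auto simp: balanced_def)
qed

end

text \<open>
  Two parallel walks are the two sides of a degenerate \<open>\<Gamma>\<^sub>k\<close>; a side that is shorter than \<open>k\<close>
  rests at its last vertex, which is what the minima below express.
\<close>

lemma parallel_walks_degenerate_Gamma:
  assumes Z: "pair_loopfree_digraph Z" and p: "dwalk Z x p y" and q: "dwalk Z x q y"
    and "length p \<le> k" "length q \<le> k"
  obtains L where "degenerate_Gamma k Z L" "dwalk L x p y" "dwalk L x q y"
proof -
  interpret Z: pair_loopfree_digraph Z by fact
  define f where "f = (\<lambda>g. case g of U i \<Rightarrow> (x # p) ! min i (length p)
    | V i \<Rightarrow> (x # q) ! min i (length q))"
  have fu: "f (gamma_u i) = (x # p) ! min i (length p)" for i by (simp add: f_def gamma_u_def)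
  \<comment> \<open>At \<open>i = 0\<close> and \<open>i = k\<close> the vertex is one of the common vertices, whose image is defined by \<open>p\<close>;
    it agrees with the value for \<open>q\<close> because both walks start at \<open>x\<close> and have arrived at \<open>y\<close> by
    position \<open>k\<close>.\<close>
  have fv: "f (gamma_v k i) = (x # q) ! min i (length q)" for i
    using dwalk_nth[OF p] dwalk_nth[OF q] assms(4,5) by (auto simp: f_def gamma_v_def min_def)
  have stutter: "((x # w) ! min i (length w), (x # w) ! min (Suc i) (length w)) \<in> parcs Z"
    if "dwalk Z x w y" "(x # w) ! min i (length w) \<noteq> (x # w) ! min (Suc i) (length w)" for w i
    using dwalk_nth[OF that(1)] that(2) by (cases "i < length w") (auto simp: min_def split: if_splits)
  have in_Z: "(x # w) ! min i (length w) \<in> pverts Z" if "dwalk Z x w y" for w i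
  proof (cases "i < length w")
    case True
    then show ?thesis using dwalk_nth[OF that] Z.arc_fst_in_verts by (fastforce simp: min_def)
  next
    case False
    then show ?thesis using dwalk_nth[OF that] dwalk_end[OF that] by (auto simp: min_def)
  qed
  have map: "graph_map (Gamma_graph k) Z f"
    using in_Z[OF p] in_Z[OF q] stutter[OF p] stutter[OF q]
    unfolding graph_map_def Gamma_graph_def by (fastforce simp: fu fv)
  define L where "L = graph_image (Gamma_graph k) f"
  have L: "f (gamma_u i) \<in> pverts L" "f (gamma_v k i) \<in> pverts L" if "i \<le> k" for i
    using that by (auto simp: L_def graph_image_def Gamma_graph_def)
  have L_arc: "f (gamma_u i) \<noteq> f (gamma_u (Suc i)) \<Longrightarrow> (f (gamma_u i), f (gamma_u (Suc i))) \<in> parcs L"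
    "f (gamma_v k i) \<noteq> f (gamma_v k (Suc i)) \<Longrightarrow> (f (gamma_v k i), f (gamma_v k (Suc i))) \<in> parcs L"
    if "i < k" for i
    using that by (auto simp: L_def graph_image_def Gamma_graph_def)
  \<comment> \<open>The image of a graph omits contracted edges, but the arcs of a walk are never contracted.\<close>
  have noloop: "(x # w) ! i \<noteq> (x # w) ! Suc i" if "dwalk Z x w y" "i < length w" for w i
    using dwalk_nth[OF that(1)] that(2) Z.no_loops by fastforce
  show ?thesis
  proof (rule that)
    show "degenerate_Gamma k Z L" using map by (auto simp: degenerate_Gamma_def L_def)
    show "dwalk L x p y"
    proof (rule dwalk_nthI)
      show "y \<in> pverts L" using L(1)[of "length p"] dwalk_nth[OF p] assms(4) by (simp add: fu)
      show "((x # p) ! i, (x # p) ! Suc i) \<in> parcs L" if "i < length p" for i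
        using L_arc(1)[of i] noloop[OF p that] that assms(4) by (simp add: fu)
    qed (use dwalk_nth[OF p] in simp)
    show "dwalk L x q y"
    proof (rule dwalk_nthI)
      show "y \<in> pverts L" using L(2)[of "length q"] dwalk_nth[OF q] assms(5) by (simp add: fv)
      show "((x # q) ! i, (x # q) ! Suc i) \<in> parcs L" if "i < length q" for i
        using L_arc(2)[of i] noloop[OF q that] that assms(5) by (simp add: fv)
    qed (use dwalk_nth[OF q] in simp)
  qed
qed

text \<open>
  For infinite \<open>r\<close> the size of the degenerate \<open>\<Gamma>\<^sub>k\<close> can be chosen freely, for finite \<open>r\<close> it has to
  be \<open>r\<close>; it is at least \<open>m\<close> in both cases.
\<close>

lemma separable_subdivision:
  assumes "separable r X Y" "1 \<le> r" "enat m \<le> r"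
  obtains k where "m \<le> k" "\<And>L. degenerate_Gamma k (graph_un X Y) L \<Longrightarrow>
    \<exists>s Ls. enat s \<le> r \<and> subdivision (graph_un X Y) L Ls \<and>
      (\<forall>M \<in> set Ls. degenerate_Gamma s X M \<or> degenerate_Gamma s Y M)"
proof (cases r)
  case (enat k)
  then show ?thesis
    using assms by (intro that[of k]) (auto simp: separable_def separable_fin_def)
next
  case infinity
  then show ?thesis
    using assms by (intro that[of "max 1 m"])
      (auto simp: separable_def separable_inf_def, meson max.cobounded1)
qed

section \<open>The pushout square\<close>

lemma gpd_functor_comp:
  assumes "groupoid G" "gpd_functor G H F" "gpd_functor H K F'"
  shows "gpd_functor G K (gpd_fun_comp F' F)"
  unfolding gpd_functor_def gpd_fun_comp_def
  using assms(2,3) groupoid.Dom_in[OF assms(1)] groupoid.Cod_in[OF assms(1)]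
  by (simp add: gpd_functorD[OF assms(2)] gpd_functorD[OF assms(3)])

lemma fund_map_incl_class:
  assumes "pverts A \<subseteq> pverts Z" "parcs A \<subseteq> parcs Z"
  shows "on_arr (fund_map r Z id) (edge_class (nerve r A) x y w) = edge_class (nerve r Z) x y w"
proof -
  have "on_arr (edge_path_functor (nerve r Z) id) (edge_class (nerve r A) x y w) =
      edge_class (nerve r Z) (id x) (id y) (map (map_step id) w)"
    using nerve_mono[OF assms] by (intro edge_path_functor_class) auto
  then show ?thesis by (simp add: fund_map_def step.map_id0)
qed

lemma gpd_functor_fund_map_incl:
  assumes "pverts A \<subseteq> pverts Z" "parcs A \<subseteq> parcs Z"
  shows "gpd_functor (fund_groupoid r A) (fund_groupoid r Z) (fund_map r Z id)"
  unfolding fund_groupoid_def fund_map_def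
  using nerve_mono[OF assms] by (intro gpd_functor_edge_path_functor edge_complex_nerve) auto

lemma on_obj_fund_map [simp]: "on_obj (fund_map r Z f) = f"
  by (simp add: fund_map_def)

lemma fund_groupoid_groupoid: "groupoid (fund_groupoid r Z)"
  unfolding fund_groupoid_def by (rule edge_complex.groupoid_edge_path_groupoid[OF edge_complex_nerve])

lemma gpd_fun_comp_simps [simp]:
  "on_obj (gpd_fun_comp K F) x = on_obj K (on_obj F x)"
  "on_arr (gpd_fun_comp K F) f = on_arr K (on_arr F f)"
  by (simp_all add: gpd_fun_comp_def)

lemma fund_groupoid_Obj: "Obj (fund_groupoid r Z) = pverts Z"
  by (simp add: fund_groupoid_def edge_path_groupoid_def nerve_0_iff)

lemma fund_groupoid_functor_eqI:
  assumes "groupoid T" "gpd_functor (fund_groupoid r Z) T F" "gpd_functor (fund_groupoid r Z) T F'"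
    and "\<And>x. x \<in> pverts Z \<Longrightarrow> on_obj F x = on_obj F' x"
    and "\<And>x y. [x, y] \<in> nerve r Z 1 \<Longrightarrow>
      on_arr F (simplex_class r Z x y) = on_arr F' (simplex_class r Z x y)"
  shows "gpd_fun_eq (fund_groupoid r Z) F F'"
  using edge_complex.functor_eqI[OF edge_complex_nerve[of r Z] assms(1)] assms(2-)
  by (simp add: fund_groupoid_def nerve_0_iff)

text \<open>
  The label of a 1-simplex \<open>(x, y)\<close> is the value of any walk of length at most \<open>r\<close> from \<open>x\<close> to
  \<open>y\<close>. For a 2-simplex \<open>(x, y, z)\<close> walks from \<open>x\<close> to \<open>y\<close> and from \<open>y\<close> to \<open>z\<close> can be chosen whose
  concatenation still has length at most \<open>r\<close>, and so computes the label of \<open>(x, z)\<close>.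
\<close>

lemma functor_of_arc_labelling:
  assumes T: "arc_labelling T Z ob e"
    and parallel: "\<And>x p q y. dwalk Z x p y \<Longrightarrow> dwalk Z x q y \<Longrightarrow> enat (length p) \<le> r \<Longrightarrow>
      enat (length q) \<le> r \<Longrightarrow> walk_value T ob e x p = walk_value T ob e x q"
  obtains H where "gpd_functor (fund_groupoid r Z) T H" "on_obj H = ob"
    "\<And>x p y. dwalk Z x p y \<Longrightarrow> enat (length p) \<le> r \<Longrightarrow>
      on_arr H (simplex_class r Z x y) = walk_value T ob e x p"
proof -
  interpret arc_labelling T Z ob e by fact
  interpret Z: pair_wf_digraph Z by (rule wf)
  define h where "h = (\<lambda>a b. walk_value T ob e a (SOME p. dwalk Z a p b \<and> enat (length p) \<le> r))"
  have h: "h a b = walk_value T ob e a p" if "dwalk Z a p b" "enat (length p) \<le> r" for a b p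
  proof -
    have "\<exists>p. dwalk Z a p b \<and> enat (length p) \<le> r" using that by blast
    from someI_ex[OF this] show ?thesis using parallel that unfolding h_def by blast
  qed
  interpret N: edge_complex "nerve r Z" by (rule edge_complex_nerve)
  interpret N: simplex_labelling "nerve r Z" T ob h
  proof
    fix x assume "[x] \<in> nerve r Z 0"
    then show "ob x \<in> Obj T" using ob by (simp add: nerve_0_iff)
  next
    fix x y assume "[x, y] \<in> nerve r Z 1"
    then obtain p where "dwalk Z x p y" "enat (length p) \<le> r" using Z.nerve_1_iff by blast
    then show "h x y \<in> Arr T" "Dom T (h x y) = ob x" "Cod T (h x y) = ob y"
      using h walk_value_in by auto
  next
    fix x assume "[x, x] \<in> nerve r Z 1"
    then have "dwalk Z x [] x" using N.face0 nerve_0_iff by fastforce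
    then show "h x x = Ident T (ob x)" using h[of x "[]" x] by (simp add: zero_enat_def[symmetric])
  next
    fix x y z assume "[x, y, z] \<in> nerve r Z 2"
    then obtain p q where pq: "dwalk Z x p y" "dwalk Z y q z" "enat (length p + length q) \<le> r"
      using Z.nerve_2_iff by blast
    then have le: "enat (length p) \<le> r" "enat (length q) \<le> r"
      by (meson enat_ord_simps(1) le_add1 le_add2 order_trans)+
    have "h x z = walk_value T ob e x (p @ q)"
      using h[OF dwalk_append[OF pq(1,2)]] pq(3) by simp
    then show "h x z = Comp T (h x y) (h y z)"
      using h[OF pq(1) le(1)] h[OF pq(2) le(2)] walk_value_append[OF pq(1,2)] by simp
  qed
  obtain H where H: "gpd_functor (edge_path_groupoid (nerve r Z)) T H" "on_obj H = ob"
    "\<And>x y. [x, y] \<in> nerve r Z 1 \<Longrightarrow> on_arr H (simplex_class r Z x y) = h x y"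
    using N.functor_exists by blast
  have "on_arr H (simplex_class r Z x y) = walk_value T ob e x p"
    if "dwalk Z x p y" "enat (length p) \<le> r" for x p y
    using H(3) h[OF that] that Z.nerve_1_iff by metis
  with H(1,2) show ?thesis using that[of H] by (simp add: fund_groupoid_def)
qed

lemma functor_determined_by_arcs:
  assumes "pair_wf_digraph Z" "groupoid T"
    and "gpd_functor (fund_groupoid r Z) T F" "gpd_functor (fund_groupoid r Z) T F'"
    and "\<And>x. x \<in> pverts Z \<Longrightarrow> on_obj F x = on_obj F' x"
    and "\<And>x y. (x, y) \<in> parcs Z \<Longrightarrow>
      on_arr F (simplex_class r Z x y) = on_arr F' (simplex_class r Z x y)"
  shows "gpd_fun_eq (fund_groupoid r Z) F F'"
proof (rule fund_groupoid_functor_eqI[OF assms(2-5)])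
  interpret pair_wf_digraph Z by fact
  fix x y assume "[x, y] \<in> nerve r Z 1"
  then obtain p where p: "dwalk Z x p y" "enat (length p) \<le> r" using nerve_1_iff by blast
  then show "on_arr F (simplex_class r Z x y) = on_arr F' (simplex_class r Z x y)"
    using functor_simplex_eq_walk_value[OF assms(3) p] functor_simplex_eq_walk_value[OF assms(4) p]
      walk_value_cong[OF p(1) assms(5,6)] by simp
qed

theorem theorem1p3:
  fixes r :: enat
    and X Y :: "'a pair_pre_digraph"
  assumes "1 \<le> r"
    and "pair_loopfree_digraph X"
    and "pair_loopfree_digraph Y"
    and "separable r X Y"
  shows "gpd_pushout TYPE('t) TYPE('u)
    (fund_groupoid r (graph_int X Y)) (fund_groupoid r X)
    (fund_groupoid r Y) (fund_groupoid r (graph_un X Y))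
    (fund_map r X id) (fund_map r Y id)
    (fund_map r (graph_un X Y) id) (fund_map r (graph_un X Y) id)"
proof -
  interpret X: pair_loopfree_digraph X by fact
  interpret Y: pair_loopfree_digraph Y by fact
  let ?Z = "graph_un X Y" and ?W = "graph_int X Y"
  have Z: "pair_loopfree_digraph ?Z"
    by unfold_locales (auto simp: graph_un_def dest: X.arc_fst_in_verts X.arc_snd_in_verts X.no_loops
      Y.arc_fst_in_verts Y.arc_snd_in_verts Y.no_loops)
  interpret Z: pair_loopfree_digraph ?Z by (rule Z)
  have W: "pair_wf_digraph ?W"
    by unfold_locales (auto simp: graph_int_def dest: X.arc_fst_in_verts X.arc_snd_in_verts
      Y.arc_fst_in_verts Y.arc_snd_in_verts)
  interpret W: pair_wf_digraph ?W by (rule W)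
  have WX: "pverts ?W \<subseteq> pverts X" "parcs ?W \<subseteq> parcs X"
    and WY: "pverts ?W \<subseteq> pverts Y" "parcs ?W \<subseteq> parcs Y"
    and XZ: "pverts X \<subseteq> pverts ?Z" "parcs X \<subseteq> parcs ?Z"
    and YZ: "pverts Y \<subseteq> pverts ?Z" "parcs Y \<subseteq> parcs ?Z"
    by (auto simp: graph_int_def graph_un_def)
  note incl = gpd_functor_fund_map_incl[OF WX] gpd_functor_fund_map_incl[OF WY]
    gpd_functor_fund_map_incl[OF XZ] gpd_functor_fund_map_incl[OF YZ]
  have comm: "gpd_fun_eq (fund_groupoid r ?W) (gpd_fun_comp (fund_map r ?Z id) (fund_map r X id))
      (gpd_fun_comp (fund_map r ?Z id) (fund_map r Y id))"
    unfolding gpd_fun_eq_def fund_groupoid_def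
    by (auto elim!: edge_complex.edge_path_groupoid_arrowE[OF edge_complex_nerve]
      simp: fund_map_incl_class[OF WX] fund_map_incl_class[OF WY] fund_map_incl_class[OF XZ]
        fund_map_incl_class[OF YZ])
  have univ: "\<exists>H. gpd_functor (fund_groupoid r ?Z) T H \<and>
      gpd_fun_eq (fund_groupoid r X) (gpd_fun_comp H (fund_map r ?Z id)) F \<and>
      gpd_fun_eq (fund_groupoid r Y) (gpd_fun_comp H (fund_map r ?Z id)) K \<and>
      (\<forall>H'. gpd_functor (fund_groupoid r ?Z) T H' \<and>
        gpd_fun_eq (fund_groupoid r X) (gpd_fun_comp H' (fund_map r ?Z id)) F \<and>
        gpd_fun_eq (fund_groupoid r Y) (gpd_fun_comp H' (fund_map r ?Z id)) K \<longrightarrow>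
        gpd_fun_eq (fund_groupoid r ?Z) H' H)"
    if T: "groupoid T" and F: "gpd_functor (fund_groupoid r X) T F"
      and K: "gpd_functor (fund_groupoid r Y) T K"
      and FK: "gpd_fun_eq (fund_groupoid r ?W) (gpd_fun_comp F (fund_map r X id))
        (gpd_fun_comp K (fund_map r Y id))"
    for T :: "('t, 'u) gpd" and F K
  proof -
    have arc_le: "enat (length [y]) \<le> r" for y :: 'a using assms(1) by (simp add: one_enat_def)
    \<comment> \<open>The two functors label the vertices and arcs of the union; their agreement on the
      intersection makes the preference for \<open>X\<close> immaterial.\<close>
    define ob where "ob = (\<lambda>a. if a \<in> pverts X then on_obj F a else on_obj K a)"
    define e where "e = (\<lambda>a b. if (a, b) \<in> parcs X then on_arr F (simplex_class r X a b)
      else on_arr K (simplex_class r Y a b))"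
    have ob_X: "on_obj F a = ob a" if "a \<in> pverts X" for a using that by (simp add: ob_def)
    have ob_Y: "on_obj K a = ob a" if "a \<in> pverts Y" for a
      using that FK by (auto simp: ob_def gpd_fun_eq_def fund_groupoid_Obj graph_int_def)
    have e_X: "on_arr F (simplex_class r X a b) = e a b" if "(a, b) \<in> parcs X" for a b
      using that by (simp add: e_def)
    have e_Y: "on_arr K (simplex_class r Y a b) = e a b" if "(a, b) \<in> parcs Y" for a b
    proof (cases "(a, b) \<in> parcs X")
      case True
      with that have "(a, b) \<in> parcs ?W" by (simp add: graph_int_def)
      then have "simplex_class r ?W a b \<in> Arr (fund_groupoid r ?W)"
        unfolding fund_groupoid_def by (rule W.simplex_class_in[OF W.dwalk_arc arc_le])
      then have "on_arr F (simplex_class r X a b) = on_arr K (simplex_class r Y a b)"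
        using FK by (auto simp: gpd_fun_eq_def fund_map_incl_class[OF WX] fund_map_incl_class[OF WY])
      then show ?thesis using True by (simp add: e_def)
    qed (simp add: e_def)
    have arc_Z: "(a, b) \<in> parcs X \<or> (a, b) \<in> parcs Y" if "(a, b) \<in> parcs ?Z" for a b
      using that by (simp add: graph_un_def)
    interpret lab: arc_labelling T ?Z ob e
    proof (intro arc_labelling.intro arc_labelling_axioms.intro T)
      show "pair_wf_digraph ?Z" by unfold_locales
      show "ob a \<in> Obj T" if "a \<in> pverts ?Z" for a
        using that gpd_functor_obj[OF F, of a] gpd_functor_obj[OF K, of a] ob_X[of a] ob_Y[of a]
        by (auto simp: graph_un_def fund_groupoid_Obj)
    next
      fix a b assume "(a, b) \<in> parcs ?Z"
      then show "e a b \<in> Arr T" "Dom T (e a b) = ob a" "Cod T (e a b) = ob b"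
        using X.functor_simplex_ends[OF F X.dwalk_arc arc_le, of a b]
          Y.functor_simplex_ends[OF K Y.dwalk_arc arc_le, of a b]
          e_X[of a b] e_Y[of a b] ob_X[of a] ob_X[of b] ob_Y[of a] ob_Y[of b]
          X.arc_fst_in_verts[of "(a, b)"] X.arc_snd_in_verts[of "(a, b)"]
          Y.arc_fst_in_verts[of "(a, b)"] Y.arc_snd_in_verts[of "(a, b)"] arc_Z[of a b]
        by auto
    qed
    \<comment> \<open>The only use of separability: two parallel walks of length at most \<open>r\<close> lie in a degenerate
      \<open>\<Gamma>\<^sub>k\<close>, which is balanced because the pieces of a subdivision are.\<close>
    have parallel: "walk_value T ob e x p = walk_value T ob e x q"
      if p: "dwalk ?Z x p y" and q: "dwalk ?Z x q y"
        and le: "enat (length p) \<le> r" "enat (length q) \<le> r" for x p q y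
    proof -
      have "enat (max (length p) (length q)) \<le> r" using le by (simp add: max_def)
      then obtain k where k: "max (length p) (length q) \<le> k"
        "\<And>L. degenerate_Gamma k ?Z L \<Longrightarrow> \<exists>s Ls. enat s \<le> r \<and> subdivision ?Z L Ls \<and>
          (\<forall>M \<in> set Ls. degenerate_Gamma s X M \<or> degenerate_Gamma s Y M)"
        using separable_subdivision[OF assms(4,1)] by metis
      obtain L where L: "degenerate_Gamma k ?Z L" "dwalk L x p y" "dwalk L x q y"
        using parallel_walks_degenerate_Gamma[OF Z p q] k(1) by auto
      obtain s Ls where Ls: "enat s \<le> r" "subdivision ?Z L Ls"
        "\<forall>M \<in> set Ls. degenerate_Gamma s X M \<or> degenerate_Gamma s Y M"
        using k(2)[OF L(1)] by blast
      have "lab.balanced M" if "M \<in> set Ls" for M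
        using Ls(3) that
          lab.balanced_degenerate_Gamma[OF X.pair_wf_digraph_axioms XZ(2) F ob_X e_X Ls(1)]
          lab.balanced_degenerate_Gamma[OF Y.pair_wf_digraph_axioms YZ(2) K ob_Y e_Y Ls(1)]
        by blast
      then have "lab.balanced L" using lab.balanced_subdivision[OF Ls(2)] by blast
      then show ?thesis using lab.balanced_parallel_walks L(2,3) p q by blast
    qed
    obtain H where H: "gpd_functor (fund_groupoid r ?Z) T H" "on_obj H = ob"
      and H_val: "\<And>x p y. dwalk ?Z x p y \<Longrightarrow> enat (length p) \<le> r \<Longrightarrow>
        on_arr H (simplex_class r ?Z x y) = walk_value T ob e x p"
    proof (rule functor_of_arc_labelling[OF lab.arc_labelling_axioms, where r = r])
      fix x p q y
      assume "dwalk ?Z x p y" "dwalk ?Z x q y" "enat (length p) \<le> r" "enat (length q) \<le> r"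
      then show "walk_value T ob e x p = walk_value T ob e x q" by (rule parallel)
    qed (rule that)
    have H_e: "on_arr H (simplex_class r ?Z a b) = e a b" if "(a, b) \<in> parcs ?Z" for a b
      using H_val[OF Z.dwalk_arc[OF that] arc_le] lab.Ident_right[OF lab.e_in[OF that]]
        lab.e_Cod[OF that] by simp
    have HX: "gpd_fun_eq (fund_groupoid r X) (gpd_fun_comp H (fund_map r ?Z id)) F"
      by (rule functor_determined_by_arcs[OF X.pair_wf_digraph_axioms T
          gpd_functor_comp[OF fund_groupoid_groupoid incl(3) H(1)] F])
        (use ob_X e_X H(2) H_e XZ(2) in \<open>auto simp: fund_map_incl_class[OF XZ]\<close>)
    have HY: "gpd_fun_eq (fund_groupoid r Y) (gpd_fun_comp H (fund_map r ?Z id)) K"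
      by (rule functor_determined_by_arcs[OF Y.pair_wf_digraph_axioms T
          gpd_functor_comp[OF fund_groupoid_groupoid incl(4) H(1)] K])
        (use ob_Y e_Y H(2) H_e YZ(2) in \<open>auto simp: fund_map_incl_class[OF YZ]\<close>)
    have "gpd_fun_eq (fund_groupoid r ?Z) H' H"
      if H': "gpd_functor (fund_groupoid r ?Z) T H'"
        and H'X: "gpd_fun_eq (fund_groupoid r X) (gpd_fun_comp H' (fund_map r ?Z id)) F"
        and H'Y: "gpd_fun_eq (fund_groupoid r Y) (gpd_fun_comp H' (fund_map r ?Z id)) K" for H'
    proof (rule functor_determined_by_arcs[OF Z.pair_wf_digraph_axioms T H' H(1)])
      fix x assume "x \<in> pverts ?Z"
      then show "on_obj H' x = on_obj H x"
        using H'X H'Y H(2) ob_X[of x] ob_Y[of x]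
        by (auto simp: gpd_fun_eq_def fund_groupoid_Obj graph_un_def)
    next
      fix x y assume xy: "(x, y) \<in> parcs ?Z"
      then consider "(x, y) \<in> parcs X" | "(x, y) \<in> parcs Y" using arc_Z by blast
      then have "on_arr H' (simplex_class r ?Z x y) = e x y"
      proof cases
        case 1
        then have "simplex_class r X x y \<in> Arr (fund_groupoid r X)"
          unfolding fund_groupoid_def by (rule X.simplex_class_in[OF X.dwalk_arc arc_le])
        with H'X e_X[OF 1] show ?thesis by (auto simp: gpd_fun_eq_def fund_map_incl_class[OF XZ])
      next
        case 2
        then have "simplex_class r Y x y \<in> Arr (fund_groupoid r Y)"
          unfolding fund_groupoid_def by (rule Y.simplex_class_in[OF Y.dwalk_arc arc_le])
        with H'Y e_Y[OF 2] show ?thesis by (auto simp: gpd_fun_eq_def fund_map_incl_class[OF YZ])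
      qed
      then show "on_arr H' (simplex_class r ?Z x y) = on_arr H (simplex_class r ?Z x y)"
        using H_e[OF xy] by simp
    qed
    with H(1) HX HY show ?thesis by blast
  qed
  show ?thesis
    unfolding gpd_pushout_def using fund_groupoid_groupoid incl comm univ by blast
qed

end
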